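(* Let $n\ge 2$, $2\le k\le n$, and let $f$ be a zonal function on $S^n$ satisfying $$\int_{\{\eta\in S^n:\ \eta_{n+1}>1-\varepsilon\}}\frac{|f(\eta)|}{(1-\eta_{n+1})^{(n+1-k)/2}}\,dS(\eta)<\infty\qquad\text{for all } 0<\varepsilon\le 2 .$$ Write $\eta\in S^n$ in spherical coordinates as $$\eta=\omega\sin\varphi+e_{n+1}\cos\varphi,\qquad \omega\in S^{n-1},\quad 0<\varphi\le\pi,$$ and set $f(\eta)=f_0(\cot(\varphi/2))$. Then $$(\mathfrak S f)(\tau\cap S^n)=F_0(t),\qquad t=\frac{|\tau|}{\sqrt{1-|\tau|^2}},\quad \tau\in\mathcal T,$$ where $$F_0(t)=2^{k-1}\sigma_{k-2}\int_t^\infty\frac{f_0(s)}{(1+s^2)^{k-1}}\,(s^2-t^2)^{(k-3)/2}\,s\,ds$$ and $\sigma_{k-2}$ is the area of the $(k-2)$-dimensional unit sphere.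
   Context: $S^n$ is the unit sphere in $\mathbb R^{n+1}$, $dS$ is its surface area measure, $e_1,\dots,e_{n+1}$ are the coordinate unit vectors, $N=e_{n+1}$ is the north pole, $\mathbb R^n=\mathbb R e_1\oplus\cdots\oplus\mathbb R e_n\subset\mathbb R^{n+1}$, and $S^{n-1}=S^n\cap\mathbb R^n$. $\mathcal T$ is the manifold of all $k$-dimensional affine planes $\tau$ in $\mathbb R^{n+1}$ passing through $N$ and intersecting $\mathbb R^n$; $|\tau|$ denotes the Euclidean distance from the origin to $\tau$ (so $|\tau|<1$). The spherical slice transform of $f$ is $(\mathfrak S f)(\tau\cap S^n)=\int_{\tau\cap S^n} f(\eta)\,dS_\tau(\eta)$, $\tau\in\mathcal T$, where $dS_\tau$ is the standard surface area measure on the subsphere $\tau\cap S^n$. A function on $S^n$ is called zonal if it is invariant under rotations about the last coordinate axis. For $k=2$, $\sigma_0=2$. *)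

theory Defs
  imports "HOL-Analysis.Analysis"
begin

text \<open>
  The space \<open>\<real>\<^sup>n\<^sup>+\<^sup>1\<close> is represented as \<open>(real^'n) \<times> real\<close> with \<open>n = CARD('n)\<close>; its norm is the
  Euclidean one and the second component is the last coordinate.
\<close>

section \<open>Surface area measure on round spheres\<close>

definition orthonormal_basis_of :: "'a::euclidean_space set \<Rightarrow> 'a set \<Rightarrow> bool" where
  "orthonormal_basis_of V B \<longleftrightarrow>
     B \<subseteq> V \<and> pairwise orthogonal B \<and> (\<forall>b\<in>B. norm b = 1) \<and> span B = V"

text \<open>
  Lebesgue measure of the dimension of \<open>V\<close> on a linear subspace \<open>V\<close>, as a Borel measure on the
  whole space: the construction of \<^const>\<open>lborel\<close>, with an orthonormal basis of \<open>V\<close> in place of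
  \<^const>\<open>Basis\<close>.  Which orthonormal basis is taken is immaterial, since Lebesgue measure is
  invariant under orthogonal maps.
\<close>
definition lborel_subspace :: "'a::euclidean_space set \<Rightarrow> 'a measure" where
  "lborel_subspace V =
     (let B = (SOME B. orthonormal_basis_of V B)
      in distr (\<Pi>\<^sub>M b\<in>B. lborel) borel (\<lambda>x. \<Sum>b\<in>B. x b *\<^sub>R b))"

text \<open>
  Surface area measure on the sphere \<open>{c + r u | u \<in> V, |u| = 1}\<close>, of dimension \<open>m - 1\<close> with
  \<open>m = dim V\<close>.  On the unit sphere of \<open>V\<close> it is the measure \<open>\<sigma>\<close> of the polar decomposition
  \<open>dx = \<rho>\<^sup>m\<^sup>-\<^sup>1 d\<rho> d\<sigma>(u)\<close> of Lebesgue measure, that is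
  \<open>\<sigma>(A) = m |{\<rho> u : u \<in> A, 0 < \<rho> \<le> 1}|\<close>; it is transported by \<open>u \<mapsto> c + r u\<close> and scaled by
  \<open>r\<^sup>m\<^sup>-\<^sup>1\<close>.  Here \<open>sgn x = x / |x|\<close>.  The measure lives on the ambient space and vanishes off
  the sphere; it is completed, so that functions need only be Lebesgue measurable on the sphere.
\<close>
definition sphere_measure :: "'a::euclidean_space set \<Rightarrow> 'a \<Rightarrow> real \<Rightarrow> 'a measure" where
  "sphere_measure V c r =
     completion
       (distr
         (density (lborel_subspace V)
            (\<lambda>x. ennreal (real (dim V) * r ^ (dim V - 1)) * indicator (cball 0 1) x))
         borel (\<lambda>x. c + r *\<^sub>R sgn x))"

text \<open>Area \<open>\<sigma>\<^sub>m\<close> of the \<open>m\<close>-dimensional unit sphere; see \<open>measure_unit_sphere\<close> below.\<close>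
definition sphere_area :: "nat \<Rightarrow> real" where
  "sphere_area m = real (m + 1) * unit_ball_vol (real (m + 1))"

lemma orthonormal_basis_of_some:
  assumes "subspace V"
  shows "orthonormal_basis_of V (SOME B. orthonormal_basis_of V B)"
proof -
  obtain B where "B \<subseteq> V" "pairwise orthogonal B" "\<And>x. x \<in> B \<Longrightarrow> norm x = 1" "span B = V"
    using orthonormal_basis_subspace[OF assms] by metis
  hence "orthonormal_basis_of V B" by (simp add: orthonormal_basis_of_def)
  thus ?thesis by (rule someI)
qed

lemma orthonormal_basis_of_finite_card:
  assumes "orthonormal_basis_of V B"
  shows "finite B" "card B = dim V"
proof -
  have "0 \<notin> B" using assms by (force simp: orthonormal_basis_of_def)
  hence ind: "independent B"
    using assms pairwise_orthogonal_independent by (auto simp: orthonormal_basis_of_def)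
  thus "finite B" using independent_imp_finite by blast
  show "card B = dim V"
    using ind assms dim_span_eq_card_independent[OF ind] by (simp add: orthonormal_basis_of_def)
qed

lemma emeasure_lborel_subspace_unit_ball:
  fixes V :: "'a::euclidean_space set"
  assumes V: "subspace V"
  shows "emeasure (lborel_subspace V) (cball 0 1) = ennreal (unit_ball_vol (real (dim V)))"
proof -
  define B where "B = (SOME B. orthonormal_basis_of V B)"
  have B: "orthonormal_basis_of V B"
    unfolding B_def by (rule orthonormal_basis_of_some[OF V])
  note fin = orthonormal_basis_of_finite_card[OF B]
  have nrm: "norm (\<Sum>b\<in>B. x b *\<^sub>R b) = sqrt (\<Sum>b\<in>B. (x b)\<^sup>2)" for x :: "'a \<Rightarrow> real"
  proof -
    have "(norm (\<Sum>b\<in>B. x b *\<^sub>R b))\<^sup>2 = (\<Sum>b\<in>B. (norm (x b *\<^sub>R b))\<^sup>2)"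
      using B fin(1)
      by (intro norm_sum_Pythagorean)
         (auto simp: pairwise_def orthogonal_def orthonormal_basis_of_def)
    also have "\<dots> = (\<Sum>b\<in>B. (x b)\<^sup>2)"
      using B by (intro sum.cong) (auto simp: orthonormal_basis_of_def)
    finally show ?thesis by (metis norm_ge_zero real_sqrt_unique)
  qed
  have "emeasure (lborel_subspace V) (cball 0 1) =
        emeasure (\<Pi>\<^sub>M b\<in>B. lborel)
          ((\<lambda>x. \<Sum>b\<in>B. x b *\<^sub>R b) -` cball 0 1 \<inter> space (\<Pi>\<^sub>M b\<in>B. lborel))"
    unfolding lborel_subspace_def Let_def B_def[symmetric]
  proof (rule emeasure_distr)
    have "(\<lambda>x. x b) \<in> borel_measurable (\<Pi>\<^sub>M b\<in>B. lborel)" if "b \<in> B" for b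
      using measurable_component_singleton[OF that, of "\<lambda>_. lborel"] by simp
    thus "(\<lambda>x. \<Sum>b\<in>B. x b *\<^sub>R b) \<in> borel_measurable (\<Pi>\<^sub>M b\<in>B. lborel)"
      by (intro borel_measurable_sum borel_measurable_scaleR) auto
  qed auto
  also have "(\<lambda>x. \<Sum>b\<in>B. x b *\<^sub>R b) -` cball 0 1 = {x. sqrt (\<Sum>b\<in>B. (x b)\<^sup>2) \<le> 1}"
    using nrm by auto
  finally show ?thesis
    using emeasure_cball_aux[of B 1] fin by simp
qed

lemma measure_unit_sphere:
  fixes V :: "'a::euclidean_space set"
  assumes V: "subspace V" and "dim V = m + 1"
  shows "measure (sphere_measure V 0 1) UNIV = sphere_area m"
proof -
  have sets [measurable_cong]: "sets (lborel_subspace V) = sets borel"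
    by (simp add: lborel_subspace_def Let_def)
  have sp: "space (lborel_subspace V) = UNIV"
    by (simp add: lborel_subspace_def Let_def)
  have [measurable]: "sgn \<in> borel_measurable (borel :: 'a measure)"
    unfolding sgn_div_norm by measurable
  have "emeasure (sphere_measure V 0 1) UNIV =
        ennreal (real (dim V)) * emeasure (lborel_subspace V) (cball 0 1)"
  proof -
    let ?M = "density (lborel_subspace V)
      (\<lambda>x. ennreal (real (dim V) * 1 ^ (dim V - 1)) * indicator (cball 0 1) x)"
    have "emeasure (sphere_measure V 0 1) UNIV = emeasure ?M UNIV"
      unfolding sphere_measure_def by (subst emeasure_completion) (auto simp: emeasure_distr sp)
    also have "\<dots> = (\<integral>\<^sup>+x. ennreal (real (dim V)) * indicator (cball 0 1) x \<partial>lborel_subspace V)"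
    proof (subst emeasure_density)
      have "(\<lambda>x. ennreal (real (dim V)) * indicator (cball 0 1) x) \<in> borel_measurable borel"
        by (intro borel_measurable_times_ennreal borel_measurable_indicator) auto
      thus "(\<lambda>x. ennreal (real (dim V) * 1 ^ (dim V - 1)) * indicator (cball 0 1) x)
          \<in> borel_measurable (lborel_subspace V)"
        by (simp add: measurable_cong_sets[OF sets refl])
    qed (simp_all add: sets)
    also have "\<dots> = ennreal (real (dim V)) * emeasure (lborel_subspace V) (cball 0 1)"
      by (subst nn_integral_cmult_indicator) (simp_all add: sets)
    finally show ?thesis .
  qed
  also have "\<dots> = ennreal (sphere_area m)"
    by (simp add: emeasure_lborel_subspace_unit_ball[OF V] sphere_area_def assms ennreal_mult
             del: of_nat_Suc of_nat_add)
  finally show ?thesis by (simp add: measure_def sphere_area_def)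
qed

section \<open>The spherical slice transform\<close>

definition north_pole :: "(real^'n) \<times> real" where
  "north_pole = (0, 1)"

definition slice_planes :: "nat \<Rightarrow> ((real^'n) \<times> real) set set" where
  "slice_planes k =
     {\<tau>. affine \<tau> \<and> aff_dim \<tau> = int k \<and> north_pole \<in> \<tau> \<and> \<tau> \<inter> {x. snd x = 0} \<noteq> {}}"

text \<open>
  Surface measure \<open>dS\<^sub>\<tau>\<close> on \<open>\<tau> \<inter> S\<^sup>n\<close>, the sphere in \<open>\<tau>\<close> about the point of \<open>\<tau>\<close> nearest to the
  origin with radius \<open>sqrt (1 - |\<tau>|\<^sup>2)\<close>, where \<open>|\<tau>| = infdist 0 \<tau>\<close>.
\<close>
definition slice_measure :: "((real^'n) \<times> real) set \<Rightarrow> ((real^'n) \<times> real) measure" where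
  "slice_measure \<tau> =
     (let c = closest_point \<tau> 0
      in sphere_measure ((\<lambda>x. x - c) ` \<tau>) c (sqrt (1 - (infdist 0 \<tau>)\<^sup>2)))"

definition slice_transform ::
  "((real^'n) \<times> real \<Rightarrow> 'b::{banach, second_countable_topology}) \<Rightarrow> ((real^'n) \<times> real) set \<Rightarrow> 'b" where
  "slice_transform f \<tau> = (LINT \<eta>|slice_measure \<tau>. f \<eta>)"

lemma slice_eq_sphere:
  fixes \<tau> :: "((real^'n) \<times> real) set"
  assumes "\<tau> \<in> slice_planes k"
  defines "c \<equiv> closest_point \<tau> 0"
  defines "r \<equiv> sqrt (1 - (infdist 0 \<tau>)\<^sup>2)"
  shows "infdist 0 \<tau> < 1" and "subspace ((\<lambda>x. x - c) ` \<tau>)" and "dim ((\<lambda>x. x - c) ` \<tau>) = k"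
    and "\<tau> \<inter> sphere 0 1 = {c + r *\<^sub>R u | u. u \<in> (\<lambda>x. x - c) ` \<tau> \<and> norm u = 1}"
proof -
  have aff: "affine \<tau>" and dm: "aff_dim \<tau> = int k" and N: "north_pole \<in> \<tau>"
    and ne: "\<tau> \<inter> {x. snd x = 0} \<noteq> {}"
    using assms by (auto simp: slice_planes_def)
  have cl: "closed \<tau>" using aff by (rule affine_closed)
  have c: "c \<in> \<tau>" unfolding c_def using N cl by (intro closest_point_in_set) auto
  have nc: "infdist 0 \<tau> = norm c"
    unfolding c_def using N cl
    using setdist_closest_point[OF cl, of 0] by (auto simp: infdist_eq_setdist)
  let ?V = "(\<lambda>x. x - c) ` \<tau>"
  show V: "subspace ?V"
    using affine_diffs_subspace_subtract[OF aff c] by simp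
  have Veq: "?V = (+) (- c) ` \<tau>" by (auto simp: image_iff)
  show "dim ?V = k"
  proof -
    have "int (dim ?V) = aff_dim ((+) (- c) ` \<tau>)"
      by (metis aff_dim_subspace V Veq)
    also have "\<dots> = int k" by (simp only: aff_dim_translation_eq dm)
    finally show ?thesis by (simp only: of_nat_eq_iff)
  qed
  have orth: "c \<bullet> v = 0" if "v \<in> ?V" for v
  proof -
    have conv: "convex \<tau>" using aff by (rule affine_imp_convex)
    have le: "c \<bullet> w \<ge> 0" if "w \<in> ?V" for w
    proof -
      from that obtain x where x: "x \<in> \<tau>" "w = x - c" by auto
      have "(0 - c) \<bullet> (x - c) \<le> 0"
        using closest_point_dot[OF conv cl x(1), of 0] by (simp add: c_def)
      thus ?thesis using x by simp
    qed
    have "- v \<in> ?V" using V that by (rule subspace_neg)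
    from le[OF this] le[OF that] show ?thesis by simp
  qed
  have pyth: "(norm (c + v))\<^sup>2 = (norm c)\<^sup>2 + (norm v)\<^sup>2" if "v \<in> ?V" for v
    using orth[OF that] by (intro norm_add_Pythagorean) (simp add: orthogonal_def)
  have N1: "norm (north_pole :: (real^'n) \<times> real) = 1" by (simp add: north_pole_def norm_prod_def)
  show lt: "infdist 0 \<tau> < 1"
  proof (rule ccontr)
    assume "\<not> ?thesis"
    hence "norm c \<ge> 1" using nc by simp
    moreover have NV: "north_pole - c \<in> ?V" using N by auto
    from pyth[OF NV] N1 have e: "1 = (norm c)\<^sup>2 + (norm (north_pole - c))\<^sup>2" by simp
    ultimately have "(norm (north_pole - c))\<^sup>2 \<le> 0"
      using one_le_power[of "norm c" 2] by linarith
    hence cN: "c = north_pole" by simp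
    from ne obtain y where y: "y \<in> \<tau>" "snd y = 0" by auto
    have "c \<bullet> (y - c) = 0" using y by (intro orth) auto
    thus False using y cN by (simp add: north_pole_def inner_prod_def)
  qed
  have r: "r > 0" "r\<^sup>2 = 1 - (norm c)\<^sup>2"
  proof -
    have "(norm c)\<^sup>2 < 1" using lt nc by (simp add: abs_square_less_1)
    thus "r > 0" "r\<^sup>2 = 1 - (norm c)\<^sup>2" by (simp_all add: r_def nc)
  qed
  show "\<tau> \<inter> sphere 0 1 = {c + r *\<^sub>R u | u. u \<in> ?V \<and> norm u = 1}" (is "?L = ?R")
  proof (intro equalityI subsetI)
    fix x assume x: "x \<in> ?L"
    have xv: "x - c \<in> ?V" using x by auto
    have "(norm (x - c))\<^sup>2 = r\<^sup>2" using pyth[OF xv] x r by simp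
    hence nr: "norm (x - c) = r"
      using power2_eq_iff_nonneg[of "norm (x - c)" r] r(1) by simp
    have "(1 / r) *\<^sub>R (x - c) \<in> ?V" using V xv by (rule subspace_scale)
    moreover have "norm ((1 / r) *\<^sub>R (x - c)) = 1" using nr r by simp
    moreover have "x = c + r *\<^sub>R ((1 / r) *\<^sub>R (x - c))" using r by simp
    ultimately show "x \<in> ?R" by blast
  next
    fix x assume "x \<in> ?R"
    then obtain u where u: "x = c + r *\<^sub>R u" "u \<in> ?V" "norm u = 1" by blast
    have ru: "r *\<^sub>R u \<in> ?V" using V u(2) by (rule subspace_scale)
    then obtain y where "y \<in> \<tau>" "r *\<^sub>R u = y - c" by auto
    hence "x \<in> \<tau>" using u by simp
    moreover have "(norm x)\<^sup>2 = 1" using pyth[OF ru] u r by (simp add: power_mult_distrib)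
    hence "norm x = 1" using power2_eq_iff_nonneg[of "norm x" 1] by simp
    ultimately show "x \<in> ?L" by simp
  qed
qed

section \<open>Zonal functions\<close>

text \<open>Rotations about the last coordinate axis are the maps \<open>(x, h) \<mapsto> (Q x, h)\<close>, \<open>Q \<in> SO(n)\<close>.\<close>
definition zonal :: "((real^'n) \<times> real \<Rightarrow> 'b) \<Rightarrow> bool" where
  "zonal f \<longleftrightarrow>
     (\<forall>Q x h. rotation_matrix Q \<longrightarrow> (x, h) \<in> sphere 0 1 \<longrightarrow> f (Q *v x, h) = f (x, h))"

text \<open>
  The functions below take the profile \<open>f0\<close> with \<open>f(\<eta>) = f0(cot (\<phi>/2))\<close>, where \<open>\<phi>\<close> is the angle
  between \<open>\<eta>\<close> and the north pole.  On the range of integration \<open>s\<^sup>2 - t\<^sup>2 > 0\<close>, as \<^const>\<open>powr\<close>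
  requires.  For \<open>k = 2\<close> the kernel is singular at \<open>s = t\<close>, and the integral may diverge for a null
  set of \<open>t\<close>.
\<close>
definition F0_integrand ::
  "nat \<Rightarrow> (real \<Rightarrow> 'b::real_vector) \<Rightarrow> real \<Rightarrow> real \<Rightarrow> 'b" where
  "F0_integrand k f0 t s =
     ((s\<^sup>2 - t\<^sup>2) powr ((real k - 3) / 2) * s / (1 + s\<^sup>2) ^ (k - 1)) *\<^sub>R f0 s"

definition F0 ::
  "nat \<Rightarrow> (real \<Rightarrow> 'b::{banach, second_countable_topology}) \<Rightarrow> real \<Rightarrow> 'b" where
  "F0 k f0 t =
     (2 ^ (k - 1) * sphere_area (k - 2)) *\<^sub>R (LINT s:{t<..}|lebesgue. F0_integrand k f0 t s)"

end

theory Submission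
  imports Defs
begin

text \<open>
  A zonal function depends on the height \<open>\<eta>\<^sub>n\<^sub>+\<^sub>1\<close> only, so its slice transform is determined by the law
  of the height under the surface measure of the slice.  Let \<open>d = \<bar>\<tau>\<bar>\<close>, let \<open>c\<close> be the point of \<open>\<tau>\<close>
  nearest to the origin, \<open>r = sqrt (1 - d\<^sup>2)\<close> the radius of the slice, and \<open>u\<close> the unit vector
  from \<open>c\<close> to the north pole.  The point \<open>c + r w\<close> of the slice has height \<open>d\<^sup>2 + r\<^sup>2 x\<close> with
  \<open>x = u \<bullet> w\<close>, and under the surface measure of the unit sphere of directions \<open>w\<close> the cosine
  \<open>x\<close> has density \<open>\<sigma>\<^sub>k\<^sub>-\<^sub>2 (1 - x\<^sup>2)\<close> to the power
  \<open>(k - 3) / 2\<close>.  In terms of \<open>s = cot (\<phi> / 2)\<close> one has \<open>1 - x\<^sup>2 = 4 (1 + t\<^sup>2) (s\<^sup>2 - t\<^sup>2) / (1 + s\<^sup>2)\<^sup>2\<close> and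
  \<open>dx = 4 (1 + t\<^sup>2) s / (1 + s\<^sup>2)\<^sup>2 ds\<close>; all powers of \<open>1 + t\<^sup>2 = 1 / r\<^sup>2\<close> cancel against \<open>r\<^sup>k\<^sup>-\<^sup>1\<close>, and the
  kernel of \<^const>\<open>F0\<close> remains.  This is \<open>nn_integral_slice_height\<close>.

  The law of \<open>x\<close> needs rotation invariance of Lebesgue measure, because surface measure is given in
  an orthonormal basis that has nothing to do with \<open>u\<close>.  \<open>nn_integral_PiM_form\<close> proves it
  for the pair of a linear form and the norm, by rotating one coordinate plane at a time;
  \<open>nn_integral_ball_cosine\<close> then integrates out the radius.

  The function \<open>f\<close> is only measurable up to null sets of the surface measure.  That the profile
  is Lebesgue measurable (\<open>measurable_profile\<close>) follows by approximating preimages from inside by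
  compact sets and taking their images under the height function.  After this, integrability and
  integrals are transported along the image law, in both directions (\<open>slice_transform_zonal\<close>).

  For convergence at almost every \<open>t\<close>, note that the whole sphere is the slice with \<open>k = n + 1\<close>,
  \<open>t = 0\<close>.  The integrability hypothesis thus becomes a weighted integrability of the profile, and
  integrating the Abel kernel over \<open>t\<close> first (\<open>AE_abel_integral_finite\<close>) gives the claim.
\<close>

lemma sphere_area_pos: "sphere_area m > 0"
  by (simp add: sphere_area_def)

section \<open>Rotation invariance of product Lebesgue measure\<close>

lemma nn_integral_lborel_swap:
  fixes H :: "real \<Rightarrow> real \<Rightarrow> ennreal"
  assumes "case_prod H \<in> borel_measurable (borel \<Otimes>\<^sub>M borel)"
  shows "(\<integral>\<^sup>+x. \<integral>\<^sup>+z. H x z \<partial>lborel \<partial>lborel) = (\<integral>\<^sup>+z. \<integral>\<^sup>+x. H x z \<partial>lborel \<partial>lborel)"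
  using lborel_pair.Fubini'[of H] assms by simp

text \<open>
  Two one-dimensional affine substitutions do the rotation: \<open>p = \<alpha> x + \<beta> z\<close> in \<open>x\<close> for fixed \<open>z\<close>,
  then \<open>z = \<beta> p + \<alpha> w\<close> for fixed \<open>p\<close>.  Their Jacobians \<open>1 / \<bar>\<alpha>\<bar>\<close> and \<open>\<bar>\<alpha>\<bar>\<close> cancel.
\<close>
lemma nn_integral_planar_rotation:
  fixes K :: "real \<Rightarrow> real \<Rightarrow> ennreal"
  assumes K [measurable]: "case_prod K \<in> borel_measurable (borel \<Otimes>\<^sub>M borel)"
    and unit: "\<alpha>\<^sup>2 + \<beta>\<^sup>2 = 1"
  shows "(\<integral>\<^sup>+x. \<integral>\<^sup>+z. K (\<alpha> * x + \<beta> * z) (x\<^sup>2 + z\<^sup>2) \<partial>lborel \<partial>lborel) =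
         (\<integral>\<^sup>+x. \<integral>\<^sup>+z. K x (x\<^sup>2 + z\<^sup>2) \<partial>lborel \<partial>lborel)"
proof (cases "\<alpha> = 0")
  case False
  have quad: "((p - \<beta> * (\<beta> * p + \<alpha> * w)) / \<alpha>)\<^sup>2 + (\<beta> * p + \<alpha> * w)\<^sup>2 = p\<^sup>2 + w\<^sup>2" for p w
  proof -
    have "p - \<beta> * (\<beta> * p + \<alpha> * w) = p * (1 - \<beta>\<^sup>2) - \<alpha> * \<beta> * w"
      by (simp add: power2_eq_square algebra_simps)
    also have "1 - \<beta>\<^sup>2 = \<alpha>\<^sup>2" using unit by simp
    also have "p * \<alpha>\<^sup>2 - \<alpha> * \<beta> * w = \<alpha> * (\<alpha> * p - \<beta> * w)"
      by (simp add: power2_eq_square algebra_simps)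
    finally have "(p - \<beta> * (\<beta> * p + \<alpha> * w)) / \<alpha> = \<alpha> * p - \<beta> * w" using False by simp
    moreover have "(\<alpha> * p - \<beta> * w)\<^sup>2 + (\<beta> * p + \<alpha> * w)\<^sup>2 = (\<alpha>\<^sup>2 + \<beta>\<^sup>2) * (p\<^sup>2 + w\<^sup>2)"
      by (simp add: power2_eq_square algebra_simps)
    ultimately show ?thesis using unit by simp
  qed
  have "(\<integral>\<^sup>+x. \<integral>\<^sup>+z. K (\<alpha> * x + \<beta> * z) (x\<^sup>2 + z\<^sup>2) \<partial>lborel \<partial>lborel) =
        (\<integral>\<^sup>+z. \<integral>\<^sup>+x. K (\<alpha> * x + \<beta> * z) (x\<^sup>2 + z\<^sup>2) \<partial>lborel \<partial>lborel)"
    by (rule nn_integral_lborel_swap) measurable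
  also have "\<dots> = (\<integral>\<^sup>+z. \<bar>1 / \<alpha>\<bar> * (\<integral>\<^sup>+p. K p (((p - \<beta> * z) / \<alpha>)\<^sup>2 + z\<^sup>2) \<partial>lborel) \<partial>lborel)"
  proof (intro nn_integral_cong)
    fix z
    show "(\<integral>\<^sup>+x. K (\<alpha> * x + \<beta> * z) (x\<^sup>2 + z\<^sup>2) \<partial>lborel) =
          \<bar>1 / \<alpha>\<bar> * (\<integral>\<^sup>+p. K p (((p - \<beta> * z) / \<alpha>)\<^sup>2 + z\<^sup>2) \<partial>lborel)"
      using False
      by (subst nn_integral_real_affine[of _ "1 / \<alpha>" "- \<beta> * z / \<alpha>"])
         (auto simp: field_simps intro!: nn_integral_cong arg_cong2[where f=K])
  qed
  also have "\<dots> = \<bar>1 / \<alpha>\<bar> * (\<integral>\<^sup>+z. \<integral>\<^sup>+p. K p (((p - \<beta> * z) / \<alpha>)\<^sup>2 + z\<^sup>2) \<partial>lborel \<partial>lborel)"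
    by (subst nn_integral_cmult) auto
  also have "(\<integral>\<^sup>+z. \<integral>\<^sup>+p. K p (((p - \<beta> * z) / \<alpha>)\<^sup>2 + z\<^sup>2) \<partial>lborel \<partial>lborel) =
             (\<integral>\<^sup>+p. \<integral>\<^sup>+z. K p (((p - \<beta> * z) / \<alpha>)\<^sup>2 + z\<^sup>2) \<partial>lborel \<partial>lborel)"
    by (rule nn_integral_lborel_swap) measurable
  also have "\<dots> = (\<integral>\<^sup>+p. \<bar>\<alpha>\<bar> * (\<integral>\<^sup>+w. K p (p\<^sup>2 + w\<^sup>2) \<partial>lborel) \<partial>lborel)"
  proof (intro nn_integral_cong)
    fix p
    show "(\<integral>\<^sup>+z. K p (((p - \<beta> * z) / \<alpha>)\<^sup>2 + z\<^sup>2) \<partial>lborel) =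
          \<bar>\<alpha>\<bar> * (\<integral>\<^sup>+w. K p (p\<^sup>2 + w\<^sup>2) \<partial>lborel)"
      using False
      by (subst nn_integral_real_affine[of _ "\<alpha>" "\<beta> * p"]) (auto simp: quad)
  qed
  also have "\<dots> = \<bar>\<alpha>\<bar> * (\<integral>\<^sup>+p. \<integral>\<^sup>+w. K p (p\<^sup>2 + w\<^sup>2) \<partial>lborel \<partial>lborel)"
    by (subst nn_integral_cmult) auto
  also have "ennreal \<bar>1 / \<alpha>\<bar> * (ennreal \<bar>\<alpha>\<bar> * (\<integral>\<^sup>+p. \<integral>\<^sup>+w. K p (p\<^sup>2 + w\<^sup>2) \<partial>lborel \<partial>lborel)) =
             (\<integral>\<^sup>+p. \<integral>\<^sup>+w. K p (p\<^sup>2 + w\<^sup>2) \<partial>lborel \<partial>lborel)"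
    using False by (simp add: mult.assoc[symmetric] ennreal_mult[symmetric])
  finally show ?thesis .
next
  case True
  then have b: "\<beta> = 1 \<or> \<beta> = -1" using unit by (simp add: power2_eq_1_iff)
  have "(\<integral>\<^sup>+x. \<integral>\<^sup>+z. K (\<beta> * z) (x\<^sup>2 + z\<^sup>2) \<partial>lborel \<partial>lborel) =
        (\<integral>\<^sup>+z. \<integral>\<^sup>+x. K (\<beta> * z) (x\<^sup>2 + z\<^sup>2) \<partial>lborel \<partial>lborel)"
    by (rule nn_integral_lborel_swap) measurable
  also have "\<dots> = (\<integral>\<^sup>+z. \<integral>\<^sup>+x. K z (x\<^sup>2 + z\<^sup>2) \<partial>lborel \<partial>lborel)"
    using b
  proof
    assume "\<beta> = -1"
    then show ?thesis
      by (subst nn_integral_real_affine[of _ "-1" 0]) auto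
  qed simp
  finally show ?thesis using True by (simp add: add.commute)
qed

lemma nn_integral_planar_form:
  fixes K :: "real \<Rightarrow> real \<Rightarrow> ennreal"
  assumes K [measurable]: "case_prod K \<in> borel_measurable (borel \<Otimes>\<^sub>M borel)"
  shows "(\<integral>\<^sup>+x. \<integral>\<^sup>+z. K (a * x + b * z) (x\<^sup>2 + z\<^sup>2) \<partial>lborel \<partial>lborel) =
         (\<integral>\<^sup>+x. \<integral>\<^sup>+z. K (sqrt (a\<^sup>2 + b\<^sup>2) * x) (x\<^sup>2 + z\<^sup>2) \<partial>lborel \<partial>lborel)"
proof (cases "a\<^sup>2 + b\<^sup>2 = 0")
  case False
  define r where "r = sqrt (a\<^sup>2 + b\<^sup>2)"
  have r: "r > 0" using False sum_power2_gt_zero_iff by (auto simp: r_def sum_power2_eq_zero_iff)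
  have "r\<^sup>2 = a\<^sup>2 + b\<^sup>2" by (simp add: r_def)
  then have "(a / r)\<^sup>2 + (b / r)\<^sup>2 = 1"
    using r False by (simp add: power_divide add_divide_distrib[symmetric])
  from nn_integral_planar_rotation[OF _ this, of "\<lambda>p q. K (r * p) q"]
  moreover have "r * (a / r * x + b / r * z) = a * x + b * z" for x z
    using r by (simp add: field_simps)
  ultimately show ?thesis by (simp add: r_def[symmetric])
qed (simp add: sum_power2_eq_zero_iff)

text \<open>
  By rotation invariance the joint law of a linear form and of the squared length depends on the
  coefficient vector \<open>v\<close> only through its length.  Each induction step rotates the plane of the
  coordinate \<open>i\<close> and the new coordinate \<open>c\<close> so that the form no longer involves \<open>c\<close>.
\<close>
lemma nn_integral_PiM_form:
  fixes G :: "real \<Rightarrow> real \<Rightarrow> ennreal"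
  assumes "finite C" and "i \<notin> C"
    and "case_prod G \<in> borel_measurable (borel \<Otimes>\<^sub>M borel)"
  shows "(\<integral>\<^sup>+x. G (\<Sum>j\<in>insert i C. v j * x j) (\<Sum>j\<in>insert i C. (x j)\<^sup>2)
            \<partial>(\<Pi>\<^sub>M j\<in>insert i C. lborel)) =
         (\<integral>\<^sup>+y. \<integral>\<^sup>+x. G (sqrt (\<Sum>j\<in>insert i C. (v j)\<^sup>2) * x) (x\<^sup>2 + (\<Sum>j\<in>C. (y j)\<^sup>2))
            \<partial>lborel \<partial>(\<Pi>\<^sub>M j\<in>C. lborel))"
  using assms
proof (induction C arbitrary: G rule: finite_induct)
  case (empty G)
  note [measurable] = \<open>case_prod G \<in> _\<close>
  interpret product_sigma_finite "\<lambda>_. lborel" by standard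
  have "(\<integral>\<^sup>+x. G (v i * x) (x\<^sup>2) \<partial>lborel) = (\<integral>\<^sup>+x. G (\<bar>v i\<bar> * x) (x\<^sup>2) \<partial>lborel)"
  proof (cases "v i \<ge> 0")
    case False
    then show ?thesis
      by (subst nn_integral_real_affine[of _ "-1" 0]) auto
  qed simp
  then show ?case
    by (simp add: nn_integral_empty product_nn_integral_singleton[where f="\<lambda>z. G (v i * z) (z\<^sup>2)"] space_PiM)
next
  case (insert c C G)
  note [measurable] = \<open>case_prod G \<in> _\<close>
  note [simp] = \<open>finite C\<close>
  interpret product_sigma_finite "\<lambda>_. lborel" by standard
  have ne: "c \<noteq> i" "i \<notin> C" "c \<notin> C" "c \<notin> insert i C" using insert by auto
  let ?n = "\<lambda>A. sqrt (\<Sum>j\<in>A. (v j)\<^sup>2)"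
  let ?P = "\<lambda>A. \<Pi>\<^sub>M j\<in>A. (lborel :: real measure)"
  have upd: "(\<Sum>j\<in>insert i C. f j ((x(c := z)) j)) = (\<Sum>j\<in>insert i C. f j (x j))"
            "(\<Sum>j\<in>C. f j ((x(c := z)) j)) = (\<Sum>j\<in>C. f j (x j))"
    for f :: "'a \<Rightarrow> real \<Rightarrow> real" and x z
    using ne by (auto intro!: sum.cong)
  have sums: "(\<Sum>j\<in>insert i (insert c C). f j) = (\<Sum>j\<in>insert i C. f j) + f c" for f :: "'a \<Rightarrow> real"
    using ne by simp
  have "(\<integral>\<^sup>+x. G (\<Sum>j\<in>insert i (insert c C). v j * x j) (\<Sum>j\<in>insert i (insert c C). (x j)\<^sup>2)
            \<partial>?P (insert i (insert c C))) =
        (\<integral>\<^sup>+x. G ((\<Sum>j\<in>insert i C. v j * x j) + v c * x c) ((\<Sum>j\<in>insert i C. (x j)\<^sup>2) + (x c)\<^sup>2)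
            \<partial>?P (insert c (insert i C)))"
    unfolding sums unfolding insert_commute[of i c C] by (rule refl)
  also have "\<dots> = (\<integral>\<^sup>+x. \<integral>\<^sup>+z. G ((\<Sum>j\<in>insert i C. v j * x j) + v c * z)
                         ((\<Sum>j\<in>insert i C. (x j)\<^sup>2) + z\<^sup>2) \<partial>lborel \<partial>?P (insert i C))"
  proof (subst product_nn_integral_insert)
    show "(\<lambda>x. G ((\<Sum>j\<in>insert i C. v j * x j) + v c * x c) ((\<Sum>j\<in>insert i C. (x j)\<^sup>2) + (x c)\<^sup>2))
            \<in> borel_measurable (?P (insert c (insert i C)))"
      by measurable
  qed (simp_all only: upd[of "\<lambda>j a. v j * a"] upd[of "\<lambda>j a. a\<^sup>2"] fun_upd_same finite_insert
         \<open>finite C\<close> ne not_False_eq_True)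
  also have "\<dots> = (\<integral>\<^sup>+y. \<integral>\<^sup>+x. \<integral>\<^sup>+z. G (?n (insert i C) * x + v c * z)
                         ((x\<^sup>2 + (\<Sum>j\<in>C. (y j)\<^sup>2)) + z\<^sup>2) \<partial>lborel \<partial>lborel \<partial>?P C)"
    using ne by (subst insert.IH[of "\<lambda>p q. \<integral>\<^sup>+z. G (p + v c * z) (q + z\<^sup>2) \<partial>lborel"]) auto
  also have "\<dots> = (\<integral>\<^sup>+y. \<integral>\<^sup>+x. \<integral>\<^sup>+z. G (?n (insert i (insert c C)) * x)
                         ((x\<^sup>2 + z\<^sup>2) + (\<Sum>j\<in>C. (y j)\<^sup>2)) \<partial>lborel \<partial>lborel \<partial>?P C)"
  proof (rule nn_integral_cong)
    fix y :: "'a \<Rightarrow> real"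
    let ?K = "\<lambda>p q. G p (q + (\<Sum>j\<in>C. (y j)\<^sup>2))"
    have "(?n (insert i C))\<^sup>2 + (v c)\<^sup>2 = (\<Sum>j\<in>insert i (insert c C). (v j)\<^sup>2)"
      using ne by (simp add: sum_nonneg)
    with nn_integral_planar_form[of ?K "?n (insert i C)" "v c"]
    show "(\<integral>\<^sup>+x. \<integral>\<^sup>+z. G (?n (insert i C) * x + v c * z)
              ((x\<^sup>2 + (\<Sum>j\<in>C. (y j)\<^sup>2)) + z\<^sup>2) \<partial>lborel \<partial>lborel) =
          (\<integral>\<^sup>+x. \<integral>\<^sup>+z. G (?n (insert i (insert c C)) * x)
              ((x\<^sup>2 + z\<^sup>2) + (\<Sum>j\<in>C. (y j)\<^sup>2)) \<partial>lborel \<partial>lborel)"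
      by (simp add: ac_simps)
  qed
  also have "\<dots> = (\<integral>\<^sup>+y. \<integral>\<^sup>+z. \<integral>\<^sup>+x. G (?n (insert i (insert c C)) * x)
                         (x\<^sup>2 + (z\<^sup>2 + (\<Sum>j\<in>C. (y j)\<^sup>2))) \<partial>lborel \<partial>lborel \<partial>?P C)"
    by (rule nn_integral_cong, subst nn_integral_lborel_swap) (measurable, simp add: ac_simps)
  also have "\<dots> = (\<integral>\<^sup>+y. \<integral>\<^sup>+x. G (?n (insert i (insert c C)) * x)
                         (x\<^sup>2 + (\<Sum>j\<in>insert c C. (y j)\<^sup>2)) \<partial>lborel \<partial>?P (insert c C))"
    using ne
    by (subst product_nn_integral_insert)
       (auto simp: upd(2)[of "\<lambda>j a. a\<^sup>2"] sum.insert[of C c] simp del: fun_upd_apply simp add: fun_upd_same)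
  finally show ?case .
qed

text \<open>
  Both measures are determined by their values on the half-lines \<open>{..r}\<close>, which are volumes of balls.
\<close>
lemma distr_PiM_norm:
  fixes C :: "'a set"
  assumes C: "finite C" and m: "card C = Suc m"
  shows "distr (\<Pi>\<^sub>M j\<in>C. lborel) borel (\<lambda>y. sqrt (\<Sum>j\<in>C. (y j)\<^sup>2)) =
         density lborel (\<lambda>q. ennreal (sphere_area m * q ^ m) * indicator {0<..} q)"
    (is "?M = ?N")
proof (rule measure_eqI_generator_eq[of "range atMost" UNIV _ _ "\<lambda>n. {..real n}"])
  have sa: "sphere_area m \<ge> 0" by (simp add: sphere_area_def)
  have E: "emeasure ?M {..r} = ennreal (if r > 0 then unit_ball_vol (real (Suc m)) * r ^ Suc m else 0)"
    for r
  proof (cases "r > 0")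
    case True
    then show ?thesis
      using emeasure_cball_aux[OF C True] m
      by (subst emeasure_distr) (auto simp: vimage_def)
  next
    case False
    \<comment> \<open>The ball of radius \<open>0\<close> is contained in balls of arbitrarily small volume.\<close>
    have *: "emeasure ?M {..0} \<le> ennreal e" if e: "e > 0" for e
    proof -
      define d where "d = min 1 (e / unit_ball_vol (real (Suc m)))"
      have pos: "unit_ball_vol (real (Suc m)) > 0" by simp
      have d: "d > 0" "d \<le> 1" "d \<le> e / unit_ball_vol (real (Suc m))" using e pos by (auto simp: d_def)
      have "emeasure ?M {..0} \<le> emeasure ?M {..d}" using d by (intro emeasure_mono) auto
      also have "\<dots> = ennreal (unit_ball_vol (real (Suc m)) * d ^ Suc m)"
        using emeasure_cball_aux[OF C d(1)] m
        by (subst emeasure_distr) (auto simp: vimage_def)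
      also have "unit_ball_vol (real (Suc m)) * d ^ Suc m \<le> unit_ball_vol (real (Suc m)) * d"
        using d pos power_decreasing[of 1 "Suc m" d] by (intro mult_left_mono) auto
      also have "unit_ball_vol (real (Suc m)) * d \<le> e"
        using d pos by (simp add: field_simps)
      finally show ?thesis by (simp add: ennreal_leI)
    qed
    have "emeasure ?M {..r} \<le> emeasure ?M {..0}" using False by (intro emeasure_mono) auto
    also have "\<dots> \<le> 0"
      by (rule ennreal_le_epsilon) (use * in auto)
    finally show ?thesis using False by simp
  qed
  show "emeasure ?M {..real i} \<noteq> \<infinity>" for i :: nat
    unfolding E by simp
  fix X :: "real set" assume "X \<in> range atMost"
  then obtain r where X: "X = {..r}" by auto
  have "emeasure ?N {..r} = (\<integral>\<^sup>+q. ennreal (sphere_area m * q ^ m) * indicator {0..r} q \<partial>lborel)"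
  proof (subst emeasure_density)
    show "(\<integral>\<^sup>+q. ennreal (sphere_area m * q ^ m) * indicator {0<..} q * indicator {..r} q \<partial>lborel) =
          (\<integral>\<^sup>+q. ennreal (sphere_area m * q ^ m) * indicator {0..r} q \<partial>lborel)"
      by (intro nn_integral_cong_AE, use AE_lborel_singleton[of 0] in eventually_elim)
         (auto simp: indicator_def)
  qed auto
  also have "\<dots> = ennreal (if r > 0 then unit_ball_vol (real (Suc m)) * r ^ Suc m else 0)"
  proof (cases "r > 0")
    case True
    have "(\<integral>\<^sup>+q. ennreal (sphere_area m * q ^ m) * indicator {0..r} q \<partial>lborel) =
       ennreal (unit_ball_vol (real (Suc m)) * r ^ Suc m - unit_ball_vol (real (Suc m)) * 0 ^ Suc m)"
      using True sa
      by (intro nn_integral_FTC_Icc)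
         (auto intro!: derivative_eq_intros simp: sphere_area_def algebra_simps
               simp del: power_Suc)
    then show ?thesis using True by simp
  next
    case False
    have "AE q in lborel. ennreal (sphere_area m * q ^ m) * indicator {0..r} q = 0"
      using AE_lborel_singleton[of 0] 
      by (rule eventually_mono) (use False in \<open>auto simp: indicator_def\<close>)
    then have "(\<integral>\<^sup>+q. ennreal (sphere_area m * q ^ m) * indicator {0..r} q \<partial>lborel) = 0"
      by (subst nn_integral_0_iff_AE) auto
    then show ?thesis using False by simp
  qed
  finally show "emeasure ?M X = emeasure ?N X" unfolding X E by simp
next
  have sb: "sets borel = sigma_sets UNIV (range (atMost :: real \<Rightarrow> real set))"
    by (simp add: borel_eq_atMost)
  show "sets ?M = sigma_sets UNIV (range atMost)" "sets ?N = sigma_sets UNIV (range atMost)"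
    by (simp_all add: sb)
qed (auto simp: Int_stable_def real_arch_simple)

section \<open>The law of the cosine on the unit ball\<close>

text \<open>
  Cylindrical coordinates about the axis \<open>v\<close>: \<open>x\<close> is the position along the axis and \<open>q\<close> the
  distance from it.
\<close>
lemma nn_integral_PiM_cylindrical:
  fixes G :: "real \<Rightarrow> real \<Rightarrow> ennreal"
  assumes B: "finite B" "card B = m + 2" and v: "(\<Sum>j\<in>B. (v j)\<^sup>2) = 1"
    and G [measurable]: "case_prod G \<in> borel_measurable (borel \<Otimes>\<^sub>M borel)"
  shows "(\<integral>\<^sup>+x. G (\<Sum>j\<in>B. v j * x j) (\<Sum>j\<in>B. (x j)\<^sup>2) \<partial>(\<Pi>\<^sub>M j\<in>B. lborel)) =
         (\<integral>\<^sup>+q. ennreal (sphere_area m * q ^ m) * indicator {0<..} q *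
            (\<integral>\<^sup>+x. G x (x\<^sup>2 + q\<^sup>2) \<partial>lborel) \<partial>lborel)"
proof -
  from B obtain i C where BC: "B = insert i C" "i \<notin> C" "finite C" "card C = Suc m"
    by (metis card_Suc_eq_finite add_2_eq_Suc')
  let ?H = "\<lambda>q. \<integral>\<^sup>+x. G x (x\<^sup>2 + q\<^sup>2) \<partial>lborel"
  have "(\<integral>\<^sup>+x. G (\<Sum>j\<in>B. v j * x j) (\<Sum>j\<in>B. (x j)\<^sup>2) \<partial>(\<Pi>\<^sub>M j\<in>B. lborel)) =
        (\<integral>\<^sup>+y. ?H (sqrt (\<Sum>j\<in>C. (y j)\<^sup>2)) \<partial>(\<Pi>\<^sub>M j\<in>C. lborel))"
    unfolding BC(1) nn_integral_PiM_form[OF BC(3,2) G] v[unfolded BC(1)]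
    by (simp add: sum_nonneg)
  also have "\<dots> = (\<integral>\<^sup>+q. ?H q \<partial>distr (\<Pi>\<^sub>M j\<in>C. lborel) borel (\<lambda>y. sqrt (\<Sum>j\<in>C. (y j)\<^sup>2)))"
    by (subst nn_integral_distr) auto
  also have "\<dots> = (\<integral>\<^sup>+q. ennreal (sphere_area m * q ^ m) * indicator {0<..} q * ?H q \<partial>lborel)"
    unfolding distr_PiM_norm[OF BC(3,4)] by (subst nn_integral_density) auto
  finally show ?thesis .
qed

text \<open>
  In cylindrical coordinates the substitution \<open>x = q y\<close> makes the cosine a function of \<open>y\<close> alone
  (\<open>y\<close> is the cotangent of the angle to the axis), and the ball becomes \<open>q \<le> 1 / sqrt (1 + y\<^sup>2)\<close>,
  so that \<open>q\<close> can be integrated out.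
\<close>
lemma nn_integral_ball_cosine:
  fixes g :: "real \<Rightarrow> ennreal"
  assumes B: "finite B" "card B = m + 2" and v: "(\<Sum>j\<in>B. (v j)\<^sup>2) = 1"
    and g [measurable]: "g \<in> borel_measurable borel"
  shows "(\<integral>\<^sup>+x. ennreal (real (m + 2)) * indicator {..1} (\<Sum>j\<in>B. (x j)\<^sup>2) *
            g ((\<Sum>j\<in>B. v j * x j) / sqrt (\<Sum>j\<in>B. (x j)\<^sup>2)) \<partial>(\<Pi>\<^sub>M j\<in>B. lborel)) =
         (\<integral>\<^sup>+y. ennreal (sphere_area m * (1 / sqrt (1 + y\<^sup>2)) ^ (m + 2)) * g (y / sqrt (1 + y\<^sup>2)) \<partial>lborel)"
proof -
  define G where "G p q = ennreal (real (m + 2)) * indicator {..1} q * g (p / sqrt q)" for p q :: real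
  have G [measurable]: "case_prod G \<in> borel_measurable (borel \<Otimes>\<^sub>M borel)"
    unfolding G_def by measurable
  have sa: "sphere_area m \<ge> 0" by (simp add: sphere_area_def)
  define w where "w y = y / sqrt (1 + y\<^sup>2)" for y :: real
  have w [measurable]: "w \<in> borel_measurable borel" unfolding w_def by measurable
  let ?e = "\<lambda>y q. ennreal (real (m + 2) * q ^ (m + 1)) * indicator {0<..1 / sqrt (1 + y\<^sup>2)} q"
  have "(\<integral>\<^sup>+x. G (\<Sum>j\<in>B. v j * x j) (\<Sum>j\<in>B. (x j)\<^sup>2) \<partial>(\<Pi>\<^sub>M j\<in>B. lborel)) =
         (\<integral>\<^sup>+q. ennreal (sphere_area m * q ^ m) * indicator {0<..} q *
            (\<integral>\<^sup>+x. G x (x\<^sup>2 + q\<^sup>2) \<partial>lborel) \<partial>lborel)"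
    using B v by (rule nn_integral_PiM_cylindrical) measurable
  also have "\<dots> = (\<integral>\<^sup>+q. \<integral>\<^sup>+y. ennreal (sphere_area m) * ?e y q * g (w y) \<partial>lborel \<partial>lborel)"
  proof (rule nn_integral_cong)
    fix q :: real
    show "ennreal (sphere_area m * q ^ m) * indicator {0<..} q * (\<integral>\<^sup>+x. G x (x\<^sup>2 + q\<^sup>2) \<partial>lborel) =
          (\<integral>\<^sup>+y. ennreal (sphere_area m) * ?e y q * g (w y) \<partial>lborel)"
    proof (cases "q > 0")
      case q: True
      have [measurable]: "Measurable.pred borel (\<lambda>y. q \<in> {0<..1 / sqrt (1 + y\<^sup>2)})"
        unfolding greaterThanAtMost_iff by measurable
      have "(\<integral>\<^sup>+x. G x (x\<^sup>2 + q\<^sup>2) \<partial>lborel) = ennreal q * (\<integral>\<^sup>+y. G (q * y) ((q * y)\<^sup>2 + q\<^sup>2) \<partial>lborel)"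
        using q by (subst nn_integral_real_affine[of _ q 0]) auto
      also have "(\<lambda>y. G (q * y) ((q * y)\<^sup>2 + q\<^sup>2)) =
                 (\<lambda>y. ennreal (real (m + 2)) * indicator {0<..1 / sqrt (1 + y\<^sup>2)} q * g (w y))"
      proof
        fix y :: real
        have pos: "sqrt (1 + y\<^sup>2) > 0" by (simp add: add_pos_nonneg)
        have *: "(q * y)\<^sup>2 + q\<^sup>2 = (q * sqrt (1 + y\<^sup>2))\<^sup>2"
          by (simp add: power_mult_distrib algebra_simps)
        have "(q * y)\<^sup>2 + q\<^sup>2 \<le> 1 \<longleftrightarrow> q * sqrt (1 + y\<^sup>2) \<le> 1"
          unfolding * using q pos by (simp add: power2_le_iff_abs_le[of 1, simplified] abs_mult)
        also have "\<dots> \<longleftrightarrow> q \<le> 1 / sqrt (1 + y\<^sup>2)" using pos by (simp add: field_simps)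
        finally have 1: "(q * y)\<^sup>2 + q\<^sup>2 \<le> 1 \<longleftrightarrow> q \<le> 1 / sqrt (1 + y\<^sup>2)" .
        have "sqrt ((q * y)\<^sup>2 + q\<^sup>2) = q * sqrt (1 + y\<^sup>2)"
          unfolding * using q pos by simp
        then have 2: "q * y / sqrt ((q * y)\<^sup>2 + q\<^sup>2) = w y" using q by (simp add: w_def)
        show "G (q * y) ((q * y)\<^sup>2 + q\<^sup>2) =
              ennreal (real (m + 2)) * indicator {0<..1 / sqrt (1 + y\<^sup>2)} q * g (w y)"
          unfolding G_def 2 using 1 q by (simp add: indicator_def)
      qed
      finally have "ennreal (sphere_area m * q ^ m) * indicator {0<..} q * (\<integral>\<^sup>+x. G x (x\<^sup>2 + q\<^sup>2) \<partial>lborel) =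
          (\<integral>\<^sup>+y. ennreal (sphere_area m * q ^ m) * ennreal q *
             (ennreal (real (m + 2)) * indicator {0<..1 / sqrt (1 + y\<^sup>2)} q * g (w y)) \<partial>lborel)"
        using q by (subst nn_integral_cmult) (simp_all add: mult.assoc)
      also have "\<dots> = (\<integral>\<^sup>+y. ennreal (sphere_area m) * ?e y q * g (w y) \<partial>lborel)"
      proof (rule nn_integral_cong)
        fix y
        have "ennreal (sphere_area m * q ^ m) * ennreal q * ennreal c =
              ennreal (sphere_area m) * ennreal (c * q ^ (m + 1))" if "c \<ge> 0" for c
          using q sa that by (simp add: ennreal_mult[symmetric] ac_simps)
        from this[of "real (m + 2)"]
        have "ennreal (sphere_area m * q ^ m) * ennreal q * ennreal (real (m + 2)) =
              ennreal (sphere_area m) * ennreal (real (m + 2) * q ^ (m + 1))"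
          by (simp only: of_nat_0_le_iff)
        then show "ennreal (sphere_area m * q ^ m) * ennreal q *
             (ennreal (real (m + 2)) * indicator {0<..1 / sqrt (1 + y\<^sup>2)} q * g (w y)) =
             ennreal (sphere_area m) * ?e y q * g (w y)"
          by (metis (no_types, lifting) mult.assoc)
      qed
      finally show ?thesis .
    qed simp
  qed
  also have "\<dots> = (\<integral>\<^sup>+y. \<integral>\<^sup>+q. ennreal (sphere_area m) * ?e y q * g (w y) \<partial>lborel \<partial>lborel)"
  proof (rule nn_integral_lborel_swap)
    have [measurable]: "Measurable.pred (borel \<Otimes>\<^sub>M borel)
        (\<lambda>x::real \<times> real. fst x \<in> {0<..1 / sqrt (1 + (snd x)\<^sup>2)})"
      unfolding greaterThanAtMost_iff by measurable
    have [measurable]: "(\<lambda>x::real \<times> real. g (w (snd x))) \<in> borel_measurable (borel \<Otimes>\<^sub>M borel)"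
      by (intro measurable_compose[OF _ g] measurable_compose[OF _ w] measurable_snd)
    show "(\<lambda>(q, y). ennreal (sphere_area m) * ?e y q * g (w y)) \<in> borel_measurable (borel \<Otimes>\<^sub>M borel)"
      unfolding case_prod_beta by measurable
  qed
  also have "\<dots> = (\<integral>\<^sup>+y. ennreal (sphere_area m * (1 / sqrt (1 + y\<^sup>2)) ^ (m + 2)) * g (w y) \<partial>lborel)"
  proof (rule nn_integral_cong)
    fix y :: real
    let ?c = "1 / sqrt (1 + y\<^sup>2)"
    have "(\<integral>\<^sup>+q. ?e y q \<partial>lborel) = (\<integral>\<^sup>+q. ennreal (real (m + 2) * q ^ (m + 1)) * indicator {0..?c} q \<partial>lborel)"
      by (intro nn_integral_cong) (auto simp: indicator_def)
    also have "\<dots> = ennreal (?c ^ (m + 2) - 0 ^ (m + 2))"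
      by (intro nn_integral_FTC_Icc) (auto intro!: derivative_eq_intros simp del: power_Suc)
    finally have E: "(\<integral>\<^sup>+q. ?e y q \<partial>lborel) = ennreal (?c ^ (m + 2))" by simp
    have "(\<integral>\<^sup>+q. ennreal (sphere_area m) * ?e y q * g (w y) \<partial>lborel) =
          ennreal (sphere_area m) * (\<integral>\<^sup>+q. ?e y q \<partial>lborel) * g (w y)"
      by (subst nn_integral_multc, simp, subst nn_integral_cmult) simp_all
    also have "\<dots> = ennreal (sphere_area m * ?c ^ (m + 2)) * g (w y)"
      unfolding E using sa by (subst ennreal_mult) simp_all
    finally show "(\<integral>\<^sup>+q. ennreal (sphere_area m) * ?e y q * g (w y) \<partial>lborel) =
        ennreal (sphere_area m * ?c ^ (m + 2)) * g (w y)"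
      .
  qed
  finally show ?thesis by (simp add: G_def w_def)
qed

section \<open>Substituting the cotangent of the half angle\<close>

text \<open>
  Exhaust the half-line by compact intervals; \<open>Y\<close> is monotone, so their images increase to the
  whole line.
\<close>
lemma nn_integral_substitution_greaterThan:
  fixes F :: "real \<Rightarrow> ennreal" and Y Y' :: "real \<Rightarrow> real"
  assumes F [measurable]: "F \<in> borel_measurable borel"
    and Y [measurable]: "Y \<in> borel_measurable borel" and Y' [measurable]: "Y' \<in> borel_measurable borel"
    and deriv: "\<And>s. s > a \<Longrightarrow> (Y has_real_derivative Y' s) (at s)"
    and cont: "continuous_on {a<..} Y'" and nonneg: "\<And>s. s > a \<Longrightarrow> Y' s \<ge> 0"
    and bot: "filterlim Y at_bot (at_right a)" and top: "filterlim Y at_top at_top"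
  shows "(\<integral>\<^sup>+y. F y \<partial>lborel) = (\<integral>\<^sup>+s. F (Y s) * ennreal (Y' s) * indicator {a<..} s \<partial>lborel)"
proof -
  define l u where "l n = a + inverse (real (Suc n))" and "u n = a + real n + 2" for n
  have lu: "a < l n" "l n < u n" for n
    by (auto simp: l_def u_def add_pos_nonneg intro: le_less_trans[of _ 1] simp: inverse_le_1_iff)
  have lu_mono: "l n \<le> l m" "u m \<le> u n" if "m \<le> n" for m n
    using that by (auto simp: l_def u_def)
  have mono: "Y x \<le> Y y" if "a < x" "x \<le> y" for x y
    using that deriv nonneg by (intro DERIV_nonneg_imp_nondecreasing[of x y Y]) (auto intro: less_le_trans)
  have au: "a < u n" for n using lu[of n] by simp
  have inc: "incseq (\<lambda>n. {l n..u n})" "incseq (\<lambda>n. {Y (l n)..Y (u n)})"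
    by (auto simp: incseq_def intro: order_trans lu_mono mono[OF lu(1) lu_mono(1)]
        order_trans[OF _ mono[OF au lu_mono(2)]] order_trans[OF mono[OF lu(1) lu_mono(1)]])
  have l_lim: "filterlim l (at_right a) sequentially"
    unfolding l_def using tendsto_add[OF tendsto_const LIMSEQ_inverse_real_of_nat, of a]
    by (auto simp: filterlim_at)
  have u_lim: "filterlim u at_top sequentially"
    unfolding u_def
    using filterlim_tendsto_add_at_top[OF tendsto_const filterlim_real_sequentially, of "a + 2"]
    by (simp add: algebra_simps)
  have UN1: "(\<Union>n. {Y (l n)..Y (u n)}) = UNIV"
  proof (intro equalityI subsetI UNIV_I)
    fix x
    have "\<forall>\<^sub>F n in sequentially. Y (l n) \<le> x"
      using filterlim_compose[OF bot l_lim] by (auto simp: filterlim_at_bot)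
    moreover have "\<forall>\<^sub>F n in sequentially. x \<le> Y (u n)"
      using filterlim_compose[OF top u_lim] by (auto simp: filterlim_at_top)
    ultimately have "\<forall>\<^sub>F n in sequentially. x \<in> {Y (l n)..Y (u n)}" by eventually_elim auto
    then show "x \<in> (\<Union>n. {Y (l n)..Y (u n)})" by (auto dest: eventually_happens)
  qed
  have UN2: "(\<Union>n. {l n..u n}) = {a<..}"
  proof (intro equalityI subsetI)
    fix x assume x: "x \<in> {a<..}"
    have "\<forall>\<^sub>F n in sequentially. l n < x"
      using l_lim x by (auto simp: filterlim_at intro: order_tendstoD)
    moreover have "\<forall>\<^sub>F n in sequentially. x \<le> u n"
      using u_lim by (auto simp: filterlim_at_top)
    ultimately have "\<forall>\<^sub>F n in sequentially. x \<in> {l n..u n}" by eventually_elim auto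
    then show "x \<in> (\<Union>n. {l n..u n})" by (auto dest: eventually_happens)
  next
    fix x assume "x \<in> (\<Union>n. {l n..u n})"
    then obtain n where "l n \<le> x" by auto
    with lu(1)[of n] show "x \<in> {a<..}" by simp
  qed
  let ?f = "\<lambda>s. F (Y s) * ennreal (Y' s)"
  have "(\<integral>\<^sup>+y. F y \<partial>lborel) = emeasure (density lborel F) (\<Union>n. {Y (l n)..Y (u n)})"
    unfolding UN1 by (subst emeasure_density) auto
  also have "\<dots> = (SUP n. emeasure (density lborel F) {Y (l n)..Y (u n)})"
    by (rule SUP_emeasure_incseq[symmetric]) (use inc in auto)
  also have "\<dots> = (SUP n. emeasure (density lborel ?f) {l n..u n})"
  proof (rule SUP_cong)
    fix n
    have "continuous_on {l n..u n} Y'"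
      using cont by (rule continuous_on_subset) (use lu(1)[of n] in auto)
    then have "(\<integral>\<^sup>+y. F y * indicator {Y (l n)..Y (u n)} y \<partial>lborel) =
               (\<integral>\<^sup>+s. ?f s * indicator {l n..u n} s \<partial>lborel)"
      using lu(2)[of n] less_le_trans[OF lu(1)[of n]] deriv nonneg
      by (intro nn_integral_substitution_aux) auto
    then show "emeasure (density lborel F) {Y (l n)..Y (u n)} = emeasure (density lborel ?f) {l n..u n}"
      by (simp add: emeasure_density)
  qed simp
  also have "\<dots> = emeasure (density lborel ?f) (\<Union>n. {l n..u n})"
    by (rule SUP_emeasure_incseq) (use inc in auto)
  also have "\<dots> = (\<integral>\<^sup>+s. ?f s * indicator {a<..} s \<partial>lborel)"
    unfolding UN2 by (subst emeasure_density) auto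
  finally show ?thesis .
qed

text \<open>
  This is the kernel of \<^const>\<open>F0\<close> together with its constant.  For \<open>s > t\<close> it turns out to be the
  density of \<open>cot (\<phi> / 2)\<close> under the surface measure of a slice.
\<close>
definition slice_density :: "nat \<Rightarrow> real \<Rightarrow> real \<Rightarrow> real" where
  "slice_density k t s =
     2 ^ (k - 1) * sphere_area (k - 2) * ((s\<^sup>2 - t\<^sup>2) powr ((real k - 3) / 2) * s / (1 + s\<^sup>2) ^ (k - 1))"

lemma measurable_slice_density [measurable]: "slice_density k t \<in> borel_measurable borel"
  unfolding slice_density_def by measurable

lemma sqrt_power_eq_powr: "sqrt X ^ j = X powr (real j / 2)" if "X > 0"
  using that by (simp add: powr_half_sqrt[symmetric] powr_power)

text \<open>
  With \<open>\<bar>\<tau>\<bar>\<^sup>2 = t\<^sup>2 / (1 + t\<^sup>2)\<close>, a point of the slice whose direction from the centre makes an angle with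
  cosine \<open>x\<close> to the direction of the north pole has height \<open>(t\<^sup>2 + x) / (1 + t\<^sup>2)\<close>.  It equals
  \<open>(s\<^sup>2 - 1) / (s\<^sup>2 + 1)\<close>, the cosine of \<open>\<phi>\<close> for \<open>s = cot (\<phi> / 2)\<close>, exactly when
  \<open>x = (s\<^sup>2 - 1 - 2 t\<^sup>2) / (s\<^sup>2 + 1)\<close>.  Since \<open>x = y / sqrt (1 + y\<^sup>2)\<close>, this is the substitution \<open>y = Y s\<close> of
  the proof.  All powers of \<open>1 + t\<^sup>2\<close> cancel against the factor in front, the power of the radius of the slice.
\<close>
lemma nn_integral_stereographic:
  fixes g :: "real \<Rightarrow> ennreal"
  assumes t: "0 \<le> t" and g [measurable]: "g \<in> borel_measurable borel"
  shows "ennreal ((1 / sqrt (1 + t\<^sup>2)) ^ (m + 1)) *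
           (\<integral>\<^sup>+y. ennreal (sphere_area m * (1 / sqrt (1 + y\<^sup>2)) ^ (m + 2)) *
              g ((t\<^sup>2 + y / sqrt (1 + y\<^sup>2)) / (1 + t\<^sup>2)) \<partial>lborel) =
         (\<integral>\<^sup>+s. ennreal (slice_density (m + 2) t s) * indicator {t<..} s * g ((s\<^sup>2 - 1) / (s\<^sup>2 + 1)) \<partial>lborel)"
proof -
  define A where "A = sqrt (1 + t\<^sup>2)"
  have A: "A > 0" "A\<^sup>2 = 1 + t\<^sup>2" by (auto simp: A_def add_pos_nonneg)
  define R where "R s = sqrt (s\<^sup>2 - t\<^sup>2)" for s
  define Y where "Y s = (s\<^sup>2 - 1 - 2 * t\<^sup>2) / (2 * A * R s)" for s
  define Y' where "Y' s = s * (1 + s\<^sup>2) / (2 * A * R s ^ 3)" for s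
  have [measurable]: "Y \<in> borel_measurable borel" "Y' \<in> borel_measurable borel"
    unfolding Y_def Y'_def R_def by measurable
  have sa: "sphere_area m \<ge> 0" by (simp add: sphere_area_def)
  have X: "s\<^sup>2 - t\<^sup>2 > 0" if "s > t" for s
    using that t by (simp add: power_strict_mono)
  have R: "R s > 0" "(R s)\<^sup>2 = s\<^sup>2 - t\<^sup>2" if "s > t" for s
    using X[OF that] by (auto simp: R_def)
  define F where "F y = ennreal (sphere_area m * (1 / sqrt (1 + y\<^sup>2)) ^ (m + 2)) *
              g ((t\<^sup>2 + y / sqrt (1 + y\<^sup>2)) / (1 + t\<^sup>2))" for y
  have [measurable]: "F \<in> borel_measurable borel" unfolding F_def by measurable
  have "(\<integral>\<^sup>+y. F y \<partial>lborel) = (\<integral>\<^sup>+s. F (Y s) * ennreal (Y' s) * indicator {t<..} s \<partial>lborel)"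
  proof (rule nn_integral_substitution_greaterThan)
    fix s assume s: "s > t"
    note Rs = R[OF s]
    have dR: "(R has_real_derivative s / R s) (at s)"
      unfolding R_def using X[OF s]
      by (auto intro!: derivative_eq_intros simp: field_simps)
    have "(Y has_real_derivative
            ((2 * s) * (2 * A * R s) - (s\<^sup>2 - 1 - 2 * t\<^sup>2) * (2 * A * (s / R s))) / ((2 * A * R s) * (2 * A * R s))) (at s)"
      unfolding Y_def using A Rs
      by (auto intro!: derivative_eq_intros dR)
    also have "((2 * s) * (2 * A * R s) - (s\<^sup>2 - 1 - 2 * t\<^sup>2) * (2 * A * (s / R s))) / ((2 * A * R s) * (2 * A * R s)) =
               s * (2 * (R s)\<^sup>2 - (s\<^sup>2 - 1 - 2 * t\<^sup>2)) / (2 * A * R s ^ 3)"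
      using A(1) Rs(1) by (simp add: field_simps power2_eq_square power3_eq_cube)
    also have "\<dots> = Y' s" unfolding Rs(2) Y'_def by (simp add: algebra_simps)
    finally show "(Y has_real_derivative Y' s) (at s)" .
    show "Y' s \<ge> 0" unfolding Y'_def using A Rs s t by (simp add: add_nonneg_nonneg)
  next
    show "continuous_on {t<..} Y'"
      unfolding Y'_def R_def using A(1)
      by (auto intro!: continuous_intros dest: X)
  next
    have "filterlim (\<lambda>s. (s\<^sup>2 - 1 - 2 * t\<^sup>2) * inverse (2 * A * R s)) at_bot (at_right t)"
    proof (rule filterlim_tendsto_neg_mult_at_bot)
      show "((\<lambda>s. s\<^sup>2 - 1 - 2 * t\<^sup>2) \<longlongrightarrow> t\<^sup>2 - 1 - 2 * t\<^sup>2) (at_right t)"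
        by (intro tendsto_intros)
      show "t\<^sup>2 - 1 - 2 * t\<^sup>2 < 0" using zero_le_power2[of t] by linarith
      have "((\<lambda>s. 2 * A * R s) \<longlongrightarrow> 2 * A * sqrt (t\<^sup>2 - t\<^sup>2)) (at_right t)"
        unfolding R_def by (intro tendsto_intros)
      moreover have "\<forall>\<^sub>F s in at_right t. 0 < 2 * A * R s"
        using eventually_at_right_less[of t] by eventually_elim (use A R in auto)
      ultimately show "filterlim (\<lambda>s. inverse (2 * A * R s)) at_top (at_right t)"
        by (intro filterlim_inverse_at_top) auto
    qed
    then show "filterlim Y at_bot (at_right t)" by (simp add: Y_def[abs_def] field_simps)
  next
    define c where "c = 1 + 2 * t\<^sup>2"
    have c: "c \<ge> 1" by (simp add: c_def)
    \<comment> \<open>Use \<open>R s \<le> s\<close> in the denominator and \<open>c \<le> c * s\<close> in the numerator.\<close>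
    have "\<forall>\<^sub>F s in at_top. (s - c) * (1 / (2 * A)) \<le> Y s"
      using eventually_ge_at_top[of c] eventually_gt_at_top[of t]
    proof eventually_elim
      case (elim s)
      then have s: "s \<ge> 1" using c by simp
      have Rle: "R s \<le> s" unfolding R_def using s by (intro real_le_lsqrt) auto
      have "(s - c) * (1 / (2 * A)) = (s\<^sup>2 - c * s) / (2 * A * s)"
        using s A by (simp add: field_simps power2_eq_square)
      also have "\<dots> \<le> (s\<^sup>2 - c) / (2 * A * s)"
        using s A c by (intro divide_right_mono) auto
      also have "\<dots> \<le> (s\<^sup>2 - c) / (2 * A * R s)"
      proof (intro divide_left_mono mult_left_mono Rle)
        have "c * 1 \<le> s * s" using s c elim by (intro mult_mono) auto
        then show "0 \<le> s\<^sup>2 - c" by (simp add: power2_eq_square)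
      qed (use A R(1)[OF elim(2)] s in auto)
      finally show ?case by (simp add: Y_def c_def algebra_simps)
    qed
    moreover have "filterlim (\<lambda>s. (s - c) * (1 / (2 * A))) at_top at_top"
      using A filterlim_tendsto_add_at_top[OF tendsto_const filterlim_ident, of "- c"]
      by (intro filterlim_at_top_mult_tendsto_pos[OF tendsto_const]) (auto simp: algebra_simps)
    ultimately show "filterlim Y at_top at_top"
      by (rule filterlim_at_top_mono[rotated])
  qed simp_all
  then have "ennreal ((1 / A) ^ (m + 1)) * (\<integral>\<^sup>+y. F y \<partial>lborel) =
       (\<integral>\<^sup>+s. ennreal ((1 / A) ^ (m + 1)) * (F (Y s) * ennreal (Y' s) * indicator {t<..} s) \<partial>lborel)"
    by (simp add: nn_integral_cmult)
  also have "\<dots> = (\<integral>\<^sup>+s. ennreal (slice_density (m + 2) t s) * indicator {t<..} s * g ((s\<^sup>2 - 1) / (s\<^sup>2 + 1)) \<partial>lborel)"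
  proof (rule nn_integral_cong)
    fix s :: real
    show "ennreal ((1 / A) ^ (m + 1)) * (F (Y s) * ennreal (Y' s) * indicator {t<..} s) =
          ennreal (slice_density (m + 2) t s) * indicator {t<..} s * g ((s\<^sup>2 - 1) / (s\<^sup>2 + 1))"
    proof (cases "s > t")
      case s: True
      note Rs = R[OF s]
      have s1: "1 + s\<^sup>2 > 0" by (simp add: add_pos_nonneg)
      \<comment> \<open>The numerator and denominator of \<open>Y s\<close> complete each other to a perfect square: this turns \<open>1 + (Y s)\<^sup>2\<close> into a square.\<close>
      have D: "(2 * A * R s)\<^sup>2 = 4 * (1 + t\<^sup>2) * (s\<^sup>2 - t\<^sup>2)"
        unfolding power_mult_distrib A(2) Rs(2) by simp
      have "(2 * A * R s)\<^sup>2 + (s\<^sup>2 - 1 - 2 * t\<^sup>2)\<^sup>2 = (1 + s\<^sup>2)\<^sup>2"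
        unfolding D by (simp add: power2_eq_square algebra_simps)
      moreover have "(2 * A * R s)\<^sup>2 > 0" using A(1) Rs(1) by simp
      ultimately have "1 + (Y s)\<^sup>2 = (1 + s\<^sup>2)\<^sup>2 / (2 * A * R s)\<^sup>2"
        unfolding Y_def power_divide by (metis add_divide_distrib divide_self less_irrefl)
      then have sq: "sqrt (1 + (Y s)\<^sup>2) = (1 + s\<^sup>2) / (2 * A * R s)"
        using A(1) Rs(1) s1 by (simp add: real_sqrt_divide)
      have "(t\<^sup>2 + Y s / sqrt (1 + (Y s)\<^sup>2)) / (1 + t\<^sup>2) = (t\<^sup>2 + (s\<^sup>2 - 1 - 2 * t\<^sup>2) / (1 + s\<^sup>2)) / (1 + t\<^sup>2)"
        unfolding sq unfolding Y_def using A(1) Rs(1) s1 by simp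
      also have "t\<^sup>2 + (s\<^sup>2 - 1 - 2 * t\<^sup>2) / (1 + s\<^sup>2) = (1 + t\<^sup>2) * ((s\<^sup>2 - 1) / (s\<^sup>2 + 1))"
        using s1 by (simp add: field_simps)
      finally have h: "(t\<^sup>2 + Y s / sqrt (1 + (Y s)\<^sup>2)) / (1 + t\<^sup>2) = (s\<^sup>2 - 1) / (s\<^sup>2 + 1)"
        using A by (simp add: add_pos_nonneg less_imp_neq[symmetric])
      define P where "P = (s\<^sup>2 - t\<^sup>2) powr ((real (m + 2) - 3) / 2)"
      have P: "R s ^ (m + 2) = P * R s ^ 3"
        unfolding P_def R_def sqrt_power_eq_powr[OF X[OF s]]
        by (simp add: powr_add[symmetric] diff_divide_distrib add_divide_distrib)
      have "(1 / A) ^ (m + 1) * ((1 / sqrt (1 + (Y s)\<^sup>2)) ^ (m + 2) * Y' s) =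
            2 ^ (m + 1) * (P * s / (1 + s\<^sup>2) ^ (m + 1))"
      proof -
        have "(1 / A) ^ (m + 1) * ((1 / sqrt (1 + (Y s)\<^sup>2)) ^ (m + 2) * Y' s) =
              (1 / A) ^ (m + 1) * ((2 * A) ^ (m + 2) * R s ^ (m + 2) / (1 + s\<^sup>2) ^ (m + 2) * Y' s)"
          unfolding sq by (simp add: power_divide power_mult_distrib)
        also have "\<dots> = 2 ^ (m + 1) * (P * s / (1 + s\<^sup>2) ^ (m + 1))"
          unfolding P Y'_def using A(1) Rs(1) s1
          by (simp add: power_mult_distrib power_divide)
        finally show ?thesis .
      qed
      moreover have "a * (S * b * z) = S * c" if "a * (b * z) = c" for a b c z S :: real
        using that by (simp add: ac_simps)
      moreover have "slice_density (m + 2) t s = sphere_area m * (2 ^ (m + 1) * (P * s / (1 + s\<^sup>2) ^ (m + 1)))"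
        by (simp add: slice_density_def P_def)
      ultimately have "(1 / A) ^ (m + 1) * (sphere_area m * (1 / sqrt (1 + (Y s)\<^sup>2)) ^ (m + 2) * Y' s) =
                 slice_density (m + 2) t s"
        by metis
      moreover have "Y' s \<ge> 0" unfolding Y'_def using A Rs s t by (simp add: add_nonneg_nonneg)
      ultimately have "ennreal ((1 / A) ^ (m + 1)) *
           (ennreal (sphere_area m * (1 / sqrt (1 + (Y s)\<^sup>2)) ^ (m + 2)) * ennreal (Y' s)) =
           ennreal (slice_density (m + 2) t s)"
        using A sa by (simp add: ennreal_mult[symmetric] del: power_Suc)
      moreover have "a * (b * G * y) = c * G" if "a * (b * y) = c" for a b c y G :: ennreal
        using that by (auto simp: ac_simps)
      moreover have "indicator {t<..} s = (1 :: ennreal)" using s by simp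
      ultimately show ?thesis
        unfolding F_def h by (simp only: mult_1_right)
    qed simp
  qed
  finally show ?thesis by (simp only: F_def A_def)
qed

section \<open>Surface measure on spheres and slices\<close>

lemma lborel_subspace_coordinates:
  fixes V :: "'a::euclidean_space set"
  assumes V: "subspace V"
  obtains B where "orthonormal_basis_of V B" "finite B" "card B = dim V"
    "\<And>f. f \<in> borel_measurable borel \<Longrightarrow>
       (\<integral>\<^sup>+x. f x \<partial>lborel_subspace V) = (\<integral>\<^sup>+x. f (\<Sum>b\<in>B. x b *\<^sub>R b) \<partial>(\<Pi>\<^sub>M b\<in>B. lborel))"
proof
  define B where "B = (SOME B. orthonormal_basis_of V B)"
  show B: "orthonormal_basis_of V B"
    unfolding B_def by (rule orthonormal_basis_of_some[OF V])
  show "finite B" "card B = dim V" using orthonormal_basis_of_finite_card[OF B] by auto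
  have [measurable]: "(\<lambda>x. \<Sum>b\<in>B. x b *\<^sub>R b) \<in> (\<Pi>\<^sub>M b\<in>B. lborel) \<rightarrow>\<^sub>M borel"
  proof -
    have "(\<lambda>x. x b) \<in> borel_measurable (\<Pi>\<^sub>M b\<in>B. lborel)" if "b \<in> B" for b
      using measurable_component_singleton[OF that, of "\<lambda>_. lborel"] by simp
    then show ?thesis by (intro borel_measurable_sum borel_measurable_scaleR) auto
  qed
  fix f :: "'a \<Rightarrow> ennreal" assume [measurable]: "f \<in> borel_measurable borel"
  show "(\<integral>\<^sup>+x. f x \<partial>lborel_subspace V) = (\<integral>\<^sup>+x. f (\<Sum>b\<in>B. x b *\<^sub>R b) \<partial>(\<Pi>\<^sub>M b\<in>B. lborel))"
    unfolding lborel_subspace_def Let_def B_def[symmetric] by (subst nn_integral_distr) auto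
qed

lemma orthonormal_coordinates:
  fixes V :: "'a::euclidean_space set"
  assumes B: "orthonormal_basis_of V B"
  shows "(\<Sum>b\<in>B. x b *\<^sub>R b) \<in> V"
    and "norm (\<Sum>b\<in>B. x b *\<^sub>R b) = sqrt (\<Sum>b\<in>B. (x b)\<^sup>2)"
    and "u \<in> V \<Longrightarrow> (\<Sum>b\<in>B. (u \<bullet> b)\<^sup>2) = (norm u)\<^sup>2"
    and "u \<bullet> (\<Sum>b\<in>B. x b *\<^sub>R b) = (\<Sum>b\<in>B. (u \<bullet> b) * x b)"
proof -
  have fin: "finite B" using orthonormal_basis_of_finite_card[OF B] by auto
  have pyth: "(norm (\<Sum>b\<in>B. y b *\<^sub>R b))\<^sup>2 = (\<Sum>b\<in>B. (y b)\<^sup>2)" for y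
  proof -
    have "(norm (\<Sum>b\<in>B. y b *\<^sub>R b))\<^sup>2 = (\<Sum>b\<in>B. (norm (y b *\<^sub>R b))\<^sup>2)"
      using B fin
      by (intro norm_sum_Pythagorean)
         (auto simp: pairwise_def orthogonal_def orthonormal_basis_of_def)
    also have "\<dots> = (\<Sum>b\<in>B. (y b)\<^sup>2)"
      using B by (intro sum.cong) (auto simp: orthonormal_basis_of_def)
    finally show ?thesis .
  qed
  show "(\<Sum>b\<in>B. x b *\<^sub>R b) \<in> V"
  proof -
    have "(\<Sum>b\<in>B. x b *\<^sub>R b) \<in> span B" by (intro span_sum span_scale span_base)
    with B show ?thesis by (simp add: orthonormal_basis_of_def)
  qed
  show "norm (\<Sum>b\<in>B. x b *\<^sub>R b) = sqrt (\<Sum>b\<in>B. (x b)\<^sup>2)"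
    using pyth[of x] by (metis norm_ge_zero real_sqrt_unique)
  show "u \<bullet> (\<Sum>b\<in>B. x b *\<^sub>R b) = (\<Sum>b\<in>B. (u \<bullet> b) * x b)"
    by (simp add: inner_sum_right mult.commute)
  assume "u \<in> V"
  then have "(\<Sum>b\<in>B. (u \<bullet> b) *\<^sub>R b) = u"
    using B fin by (intro orthonormal_basis_expand) (auto simp: orthonormal_basis_of_def)
  with pyth[of "\<lambda>b. u \<bullet> b"] show "(\<Sum>b\<in>B. (u \<bullet> b)\<^sup>2) = (norm u)\<^sup>2" by simp
qed

text \<open>
  The surface measure before completion; image measures and substitutions are computed for it, and
  null sets are added at the end.
\<close>
definition borel_sphere_measure :: "'a::euclidean_space set \<Rightarrow> 'a \<Rightarrow> real \<Rightarrow> 'a measure" where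
  "borel_sphere_measure V c r =
     distr
       (density (lborel_subspace V)
          (\<lambda>x. ennreal (real (dim V) * r ^ (dim V - 1)) * indicator (cball 0 1) x))
       borel (\<lambda>x. c + r *\<^sub>R sgn x)"

lemma sphere_measure_eq_completion: "sphere_measure V c r = completion (borel_sphere_measure V c r)"
  by (simp add: sphere_measure_def borel_sphere_measure_def)

lemma sets_borel_sphere_measure [simp, measurable_cong]:
  "sets (borel_sphere_measure V c r) = sets borel"
  by (simp add: borel_sphere_measure_def)

lemma space_borel_sphere_measure [simp]: "space (borel_sphere_measure V c r) = UNIV"
  by (simp add: borel_sphere_measure_def)

lemma sets_lborel_subspace [simp, measurable_cong]: "sets (lborel_subspace V) = sets borel"
  by (simp add: lborel_subspace_def Let_def)

lemma measurable_sgn [measurable]: "sgn \<in> borel_measurable (borel :: 'a::euclidean_space measure)"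
  unfolding sgn_div_norm by measurable

lemma measurable_cball [measurable]: "cball a e \<in> sets (borel :: 'a::euclidean_space measure)"
  by (intro borel_closed closed_cball)

lemma nn_integral_borel_sphere_measure:
  fixes V :: "'a::euclidean_space set" and g :: "'a \<Rightarrow> ennreal"
  assumes [measurable]: "g \<in> borel_measurable borel"
  shows "(\<integral>\<^sup>+\<eta>. g \<eta> \<partial>borel_sphere_measure V c r) =
    (\<integral>\<^sup>+x. ennreal (real (dim V) * r ^ (dim V - 1)) * indicator (cball 0 1) x * g (c + r *\<^sub>R sgn x)
       \<partial>lborel_subspace V)"
  unfolding borel_sphere_measure_def
  by (subst nn_integral_distr, simp_all, subst nn_integral_density, simp_all)

text \<open>
  An integrand that depends only on the angle to a fixed axis \<open>u\<close> reduces to the law of the cosine.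
  The variable \<open>y\<close> on the right is the cotangent of that angle.
\<close>
lemma nn_integral_borel_sphere_measure_axial:
  fixes V :: "'a::euclidean_space set" and g :: "'a \<Rightarrow> ennreal"
  assumes V: "subspace V" and dim: "dim V = m + 2" and u: "u \<in> V" "norm u = 1" and r: "r \<ge> 0"
    and g [measurable]: "g \<in> borel_measurable borel" and \<gamma> [measurable]: "\<gamma> \<in> borel_measurable borel"
    and eq: "\<And>x. x \<in> V \<Longrightarrow> g (c + r *\<^sub>R sgn x) = \<gamma> (u \<bullet> x / norm x)"
  shows "(\<integral>\<^sup>+\<eta>. g \<eta> \<partial>borel_sphere_measure V c r) =
    ennreal (r ^ (m + 1)) * (\<integral>\<^sup>+y. ennreal (sphere_area m * (1 / sqrt (1 + y\<^sup>2)) ^ (m + 2)) *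
       \<gamma> (y / sqrt (1 + y\<^sup>2)) \<partial>lborel)"
proof -
  obtain B where B: "orthonormal_basis_of V B" "finite B" "card B = dim V"
    and int: "\<And>f. f \<in> borel_measurable borel \<Longrightarrow>
       (\<integral>\<^sup>+x. f x \<partial>lborel_subspace V) = (\<integral>\<^sup>+x. f (\<Sum>b\<in>B. x b *\<^sub>R b) \<partial>(\<Pi>\<^sub>M b\<in>B. lborel))"
    using lborel_subspace_coordinates[OF V] by blast
  note co = orthonormal_coordinates[OF B(1)]
  have "(\<integral>\<^sup>+\<eta>. g \<eta> \<partial>borel_sphere_measure V c r) =
        (\<integral>\<^sup>+x. ennreal (real (m + 2) * r ^ (m + 1)) * indicator (cball 0 1) (\<Sum>b\<in>B. x b *\<^sub>R b) *
           g (c + r *\<^sub>R sgn (\<Sum>b\<in>B. x b *\<^sub>R b)) \<partial>(\<Pi>\<^sub>M b\<in>B. lborel))"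
    unfolding nn_integral_borel_sphere_measure[OF g] dim by (subst int) simp_all
  also have "\<dots> = (\<integral>\<^sup>+x. ennreal (r ^ (m + 1)) * (ennreal (real (m + 2)) * indicator {..1} (\<Sum>j\<in>B. (x j)\<^sup>2) *
            \<gamma> ((\<Sum>j\<in>B. (u \<bullet> j) * x j) / sqrt (\<Sum>j\<in>B. (x j)\<^sup>2))) \<partial>(\<Pi>\<^sub>M j\<in>B. lborel))"
  proof (rule nn_integral_cong)
    fix x :: "'a \<Rightarrow> real"
    have "ennreal (d * r ^ (m + 1)) = ennreal (r ^ (m + 1)) * ennreal d" if "d \<ge> 0" for d
      using r that by (simp add: ennreal_mult[symmetric] mult.commute)
    then have "ennreal (real (m + 2) * r ^ (m + 1)) = ennreal (r ^ (m + 1)) * ennreal (real (m + 2))"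
      by (simp only: of_nat_0_le_iff)
    moreover have "indicator (cball 0 1) (\<Sum>b\<in>B. x b *\<^sub>R b) = (indicator {..1} (\<Sum>j\<in>B. (x j)\<^sup>2) :: ennreal)"
      using co(2)[of x] by (simp add: indicator_def)
    moreover have "g (c + r *\<^sub>R sgn (\<Sum>b\<in>B. x b *\<^sub>R b)) =
        \<gamma> ((\<Sum>j\<in>B. (u \<bullet> j) * x j) / sqrt (\<Sum>j\<in>B. (x j)\<^sup>2))"
      unfolding eq[OF co(1)] co(2) co(4) ..
    ultimately show "ennreal (real (m + 2) * r ^ (m + 1)) * indicator (cball 0 1) (\<Sum>b\<in>B. x b *\<^sub>R b) *
           g (c + r *\<^sub>R sgn (\<Sum>b\<in>B. x b *\<^sub>R b)) =
        ennreal (r ^ (m + 1)) * (ennreal (real (m + 2)) * indicator {..1} (\<Sum>j\<in>B. (x j)\<^sup>2) *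
            \<gamma> ((\<Sum>j\<in>B. (u \<bullet> j) * x j) / sqrt (\<Sum>j\<in>B. (x j)\<^sup>2)))"
      by (simp only: mult.assoc)
  qed
  also have "\<dots> = ennreal (r ^ (m + 1)) * (\<integral>\<^sup>+x. ennreal (real (m + 2)) * indicator {..1} (\<Sum>j\<in>B. (x j)\<^sup>2) *
            \<gamma> ((\<Sum>j\<in>B. (u \<bullet> j) * x j) / sqrt (\<Sum>j\<in>B. (x j)\<^sup>2)) \<partial>(\<Pi>\<^sub>M j\<in>B. lborel))"
    by (subst nn_integral_cmult) simp_all
  also have "(\<integral>\<^sup>+x. ennreal (real (m + 2)) * indicator {..1} (\<Sum>j\<in>B. (x j)\<^sup>2) *
            \<gamma> ((\<Sum>j\<in>B. (u \<bullet> j) * x j) / sqrt (\<Sum>j\<in>B. (x j)\<^sup>2)) \<partial>(\<Pi>\<^sub>M j\<in>B. lborel)) =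
     (\<integral>\<^sup>+y. ennreal (sphere_area m * (1 / sqrt (1 + y\<^sup>2)) ^ (m + 2)) * \<gamma> (y / sqrt (1 + y\<^sup>2)) \<partial>lborel)"
    using co(3)[OF u(1)] u(2) B dim by (intro nn_integral_ball_cosine) simp_all
  finally show ?thesis .
qed

text \<open>
  The surface measure is an image under \<^const>\<open>sgn\<close>, which sends the origin to itself instead of to
  the unit sphere; the origin of \<open>V\<close> is a null set because the integral in cylindrical coordinates
  only involves \<open>q > 0\<close>.
\<close>
lemma AE_borel_sphere_measure:
  fixes V :: "'a::euclidean_space set"
  assumes V: "subspace V" and dim: "dim V = m + 2"
  shows "AE \<eta> in borel_sphere_measure V c r. \<exists>u\<in>V. norm u = 1 \<and> \<eta> = c + r *\<^sub>R u"
proof -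
  obtain B where B: "orthonormal_basis_of V B" "finite B" "card B = dim V"
    and int: "\<And>f. f \<in> borel_measurable borel \<Longrightarrow>
       (\<integral>\<^sup>+x. f x \<partial>lborel_subspace V) = (\<integral>\<^sup>+x. f (\<Sum>b\<in>B. x b *\<^sub>R b) \<partial>(\<Pi>\<^sub>M b\<in>B. lborel))"
    using lborel_subspace_coordinates[OF V] by blast
  note co = orthonormal_coordinates[OF B(1)]
  have clV: "closed V" using V by (rule closed_subspace)
  have "V \<noteq> {0}" using dim by auto
  then obtain w where w: "w \<in> V" "w \<noteq> 0" using subspace_0[OF V] by blast
  define u where "u = sgn w"
  have u: "u \<in> V" "norm u = 1" using w V
    by (auto simp: u_def norm_sgn sgn_div_norm subspace_scale)
  let ?Z = "UNIV - (\<lambda>x. c + r *\<^sub>R x) ` (V \<inter> sphere 0 1)"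
  have "compact (V \<inter> sphere 0 1)" using clV by (simp add: closed_Int_compact)
  then have "closed ((\<lambda>x. c + r *\<^sub>R x) ` (V \<inter> sphere 0 1))"
    by (intro compact_imp_closed compact_continuous_image continuous_intros)
  then have Z [measurable]: "?Z \<in> sets borel" by (intro borel_open) (simp add: open_Diff)
  have [measurable]: "insert 0 (- V) \<in> sets borel"
    using clV by (subst insert_is_Un) (intro sets.Un borel_open borel_closed, auto)
  have "(\<integral>\<^sup>+x. indicator (insert 0 (- V)) x \<partial>lborel_subspace V) = 0"
  proof -
    have "(\<integral>\<^sup>+x. indicator (insert 0 (- V)) x \<partial>lborel_subspace V) =
          (\<integral>\<^sup>+x. indicator (insert 0 (- V)) (\<Sum>b\<in>B. x b *\<^sub>R b) \<partial>(\<Pi>\<^sub>M b\<in>B. lborel))"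
      by (rule int) simp
    also have "\<dots> = (\<integral>\<^sup>+x. (\<lambda>p q. indicator {0} q) (\<Sum>j\<in>B. (u \<bullet> j) * x j) (\<Sum>j\<in>B. (x j)\<^sup>2) \<partial>(\<Pi>\<^sub>M j\<in>B. lborel))"
    proof (rule nn_integral_cong)
      fix x :: "'a \<Rightarrow> real"
      have "(\<Sum>b\<in>B. x b *\<^sub>R b) = 0 \<longleftrightarrow> (\<Sum>j\<in>B. (x j)\<^sup>2) = 0"
        using co(2)[of x] by (metis norm_eq_zero real_sqrt_eq_0_iff)
      then show "indicator (insert 0 (- V)) (\<Sum>b\<in>B. x b *\<^sub>R b) =
          ((\<lambda>p q. indicator {0} q) (\<Sum>j\<in>B. (u \<bullet> j) * x j) (\<Sum>j\<in>B. (x j)\<^sup>2) :: ennreal)"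
        using co(1)[of x] by (simp add: indicator_def)
    qed
    also have "\<dots> = (\<integral>\<^sup>+q. ennreal (sphere_area m * q ^ m) * indicator {0<..} q *
            (\<integral>\<^sup>+x. indicator {0} (x\<^sup>2 + q\<^sup>2) \<partial>lborel) \<partial>(lborel :: real measure))"
      using co(3)[OF u(1)] u(2) B dim by (intro nn_integral_PiM_cylindrical) simp_all
    also have "\<dots> = (\<integral>\<^sup>+q. 0 \<partial>(lborel :: real measure))"
    proof (rule nn_integral_cong)
      fix q :: real
      have "(\<integral>\<^sup>+x. indicator {0} (x\<^sup>2 + q\<^sup>2) \<partial>lborel) = (\<integral>\<^sup>+x. 0 \<partial>(lborel :: real measure))" if "q > 0"
        using that by (intro nn_integral_cong) (auto simp: indicator_def sum_power2_eq_zero_iff)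
      then show "ennreal (sphere_area m * q ^ m) * indicator {0<..} q *
            (\<integral>\<^sup>+x. indicator {0} (x\<^sup>2 + q\<^sup>2) \<partial>(lborel :: real measure)) = 0"
        by (cases "q > 0") auto
    qed
    finally show ?thesis by simp
  qed
  then have AE1: "AE x in lborel_subspace V. x \<notin> insert 0 (- V)"
    by (subst (asm) nn_integral_0_iff_AE) (auto simp: indicator_def split: if_splits)
  have "(\<integral>\<^sup>+\<eta>. indicator ?Z \<eta> \<partial>borel_sphere_measure V c r) = 0"
  proof (subst nn_integral_borel_sphere_measure)
    have "AE x in lborel_subspace V. indicator ?Z (c + r *\<^sub>R sgn x) = (0 :: ennreal)"
      using AE1
    proof eventually_elim
      case (elim x)
      then have "sgn x \<in> V" "norm (sgn x) = 1"
        using V by (auto simp: norm_sgn sgn_div_norm subspace_scale)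
      then show ?case by (auto simp: indicator_def image_iff)
    qed
    then have "AE x in lborel_subspace V. ennreal (real (dim V) * r ^ (dim V - 1)) *
        indicator (cball 0 1) x * indicator ?Z (c + r *\<^sub>R sgn x) = 0"
      by (rule eventually_mono) simp
    then show "(\<integral>\<^sup>+x. ennreal (real (dim V) * r ^ (dim V - 1)) * indicator (cball 0 1) x *
        indicator ?Z (c + r *\<^sub>R sgn x) \<partial>lborel_subspace V) = 0"
      by (subst nn_integral_cong_AE[where v="\<lambda>_. 0"]) simp_all
  qed simp
  then have "AE \<eta> in borel_sphere_measure V c r. \<eta> \<notin> ?Z"
    by (subst (asm) nn_integral_0_iff_AE) (auto simp: indicator_def split: if_splits elim!: eventually_mono)
  then show ?thesis by (rule eventually_mono) auto
qed

lemma measurable_snd_borel [measurable]: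
  "snd \<in> borel_measurable (borel :: ('a::second_countable_topology \<times> 'b::second_countable_topology) measure)"
  by (intro borel_measurable_continuous_onI continuous_intros)

definition borel_slice_measure :: "((real^'n) \<times> real) set \<Rightarrow> ((real^'n) \<times> real) measure" where
  "borel_slice_measure \<tau> =
     (let c = closest_point \<tau> 0
      in borel_sphere_measure ((\<lambda>x. x - c) ` \<tau>) c (sqrt (1 - (infdist 0 \<tau>)\<^sup>2)))"

lemma slice_measure_eq_completion: "slice_measure \<tau> = completion (borel_slice_measure \<tau>)"
  by (simp add: slice_measure_def borel_slice_measure_def Let_def sphere_measure_eq_completion)

lemma sets_borel_slice_measure [simp, measurable_cong]:
  "sets (borel_slice_measure \<tau>) = sets borel"
  by (simp add: borel_slice_measure_def Let_def)

lemma space_borel_slice_measure [simp]: "space (borel_slice_measure \<tau>) = UNIV"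
  by (simp add: borel_slice_measure_def Let_def)

text \<open>
  Let \<open>c\<close> be the point of \<open>\<tau>\<close> nearest to the origin, \<open>d = \<bar>c\<bar>\<close>, \<open>r\<^sup>2 = 1 - d\<^sup>2\<close>, and \<open>u\<close> the unit vector
  from \<open>c\<close> towards the north pole.  As \<open>c\<close> is orthogonal to the direction space of \<open>\<tau>\<close>, the height
  of \<open>c + r w\<close> is \<open>d\<^sup>2 + r\<^sup>2 (u \<bullet> w)\<close>, a function of the angle to the axis \<open>u\<close>.
\<close>
lemma nn_integral_slice_height:
  fixes \<tau> :: "((real^'n) \<times> real) set" and g :: "real \<Rightarrow> ennreal"
  assumes \<tau>: "\<tau> \<in> slice_planes k" and k: "2 \<le> k"
  defines "t \<equiv> infdist 0 \<tau> / sqrt (1 - (infdist 0 \<tau>)\<^sup>2)"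
  shows "g \<in> borel_measurable borel \<Longrightarrow> (\<integral>\<^sup>+\<eta>. g (snd \<eta>) \<partial>borel_slice_measure \<tau>) =
     (\<integral>\<^sup>+s. ennreal (slice_density k t s) * indicator {t<..} s * g ((s\<^sup>2 - 1) / (s\<^sup>2 + 1)) \<partial>lborel)"
    and "AE \<eta> in borel_slice_measure \<tau>. \<eta> \<in> sphere 0 1"
proof -
  define c where "c = closest_point \<tau> 0"
  define V where "V = (\<lambda>x. x - c) ` \<tau>"
  define d where "d = infdist 0 \<tau>"
  define r where "r = sqrt (1 - d\<^sup>2)"
  obtain m where m: "k = m + 2" using k by (metis le_add_diff_inverse2)
  have M: "borel_slice_measure \<tau> = borel_sphere_measure V c r"
    by (simp add: borel_slice_measure_def Let_def V_def c_def r_def d_def)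
  note se = slice_eq_sphere[OF \<tau>, folded c_def, folded V_def d_def, folded r_def]
  have d: "0 \<le> d" "d < 1" using se(1) by (auto simp: d_def infdist_nonneg)
  have V: "subspace V" and dim: "dim V = m + 2" using se(2,3) m by auto
  have r: "r > 0" "r\<^sup>2 = 1 - d\<^sup>2"
    using d abs_square_less_1[of d] by (auto simp: r_def)
  have on: "norm (c + r *\<^sub>R u) = 1" if "u \<in> V" "norm u = 1" for u
  proof -
    have "c + r *\<^sub>R u \<in> \<tau> \<inter> sphere 0 1" unfolding se(4) using that by blast
    then show ?thesis by simp
  qed
  \<comment> \<open>Compare the lengths of the points \<open>c + r u\<close> and \<open>c - r u\<close> of the sphere.\<close>
  have unit: "c \<bullet> u = 0 \<and> (norm c)\<^sup>2 = d\<^sup>2" if u: "u \<in> V" "norm u = 1" for u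
  proof -
    have e: "(norm (c + r *\<^sub>R w))\<^sup>2 = (norm c)\<^sup>2 + 2 * r * (c \<bullet> w) + r\<^sup>2" if "norm w = 1" for w
    proof -
      have "w \<bullet> w = 1" using that by (simp add: norm_eq_1)
      then show ?thesis
        unfolding power2_norm_eq_inner
        by (simp add: inner_add_left inner_add_right inner_commute power2_eq_square algebra_simps)
    qed
    from u V have u': "- u \<in> V" by (simp add: subspace_neg)
    have "(norm c)\<^sup>2 + 2 * r * (c \<bullet> u) + r\<^sup>2 = 1" "(norm c)\<^sup>2 - 2 * r * (c \<bullet> u) + r\<^sup>2 = 1"
      using e[of u] e[of "- u"] on[of u] on[of "- u"] u u' by simp_all
    then have "4 * (r * (c \<bullet> u)) = 0" "(norm c)\<^sup>2 = 1 - r\<^sup>2" by linarith+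
    with r show ?thesis by simp
  qed
  have "V \<noteq> {0}" using dim by auto
  then obtain w where w: "w \<in> V" "w \<noteq> 0" using subspace_0[OF V] by blast
  have sgnV: "sgn v \<in> V \<and> norm (sgn v) = 1" if "v \<in> V" "v \<noteq> 0" for v
    using that V by (auto simp: norm_sgn sgn_div_norm subspace_scale)
  have nc: "(norm c)\<^sup>2 = d\<^sup>2" using unit sgnV[OF w] by blast
  have orth: "c \<bullet> v = 0" if "v \<in> V" for v
  proof (cases "v = 0")
    case False
    then have "c \<bullet> sgn v = 0" using unit sgnV[OF that] by blast
    then show ?thesis using False by (simp add: sgn_div_norm)
  qed simp
  define u where "u = (1 / r) *\<^sub>R (north_pole - c)"
  have NV: "north_pole - c \<in> V" using \<tau> by (auto simp: V_def slice_planes_def)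
  have cN: "c \<bullet> north_pole = d\<^sup>2"
    using orth[OF NV] nc by (simp add: inner_diff_right power2_norm_eq_inner)
  have NN: "(north_pole :: (real^'n) \<times> real) \<bullet> north_pole = 1"
    by (simp add: north_pole_def inner_prod_def)
  have uV: "u \<in> V" unfolding u_def using V NV by (rule subspace_scale)
  have "(norm (north_pole - c))\<^sup>2 = r\<^sup>2"
    using cN NN nc r(2) unfolding power2_norm_eq_inner
    by (simp add: inner_diff_left inner_diff_right inner_commute)
  then have u1: "norm u = 1" using r(1) by (simp add: u_def)
  have height: "snd (c + r *\<^sub>R sgn x) = d\<^sup>2 + r\<^sup>2 * (u \<bullet> x / norm x)" if "x \<in> V" for x
  proof -
    have "snd y = north_pole \<bullet> y" for y :: "(real^'n) \<times> real"
      by (simp add: north_pole_def inner_prod_def)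
    then have "snd (c + r *\<^sub>R sgn x) = d\<^sup>2 + r * (north_pole \<bullet> sgn x)"
      using cN by (simp add: inner_add_right inner_commute)
    also have "north_pole = r *\<^sub>R u + c" using r by (simp add: u_def)
    also have "(r *\<^sub>R u + c) \<bullet> sgn x = r * (u \<bullet> x / norm x)"
      using orth[OF that] by (simp add: inner_add_left sgn_div_norm field_simps)
    finally show ?thesis by (simp add: power2_eq_square)
  qed
  have t: "0 \<le> t" "t = d / r" using d r by (auto simp: t_def d_def r_def)
  have "1 + t\<^sup>2 = 1 / r\<^sup>2" using r by (simp add: t(2) power_divide field_simps)
  then have tr: "r = 1 / sqrt (1 + t\<^sup>2)" "r\<^sup>2 = 1 / (1 + t\<^sup>2)"
    using r(1) by (simp_all add: real_sqrt_divide)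
  have d2: "d\<^sup>2 = t\<^sup>2 * r\<^sup>2" using r(1) by (simp add: t(2) power_divide)
  have hx: "d\<^sup>2 + r\<^sup>2 * z = (t\<^sup>2 + z) / (1 + t\<^sup>2)" for z
    unfolding d2 tr(2) by (simp add: add_divide_distrib)
  show "AE \<eta> in borel_slice_measure \<tau>. \<eta> \<in> sphere 0 1"
    unfolding M using AE_borel_sphere_measure[OF V dim]
    by (rule eventually_mono) (use on in auto)
  assume g [measurable]: "g \<in> borel_measurable borel"
  have "(\<integral>\<^sup>+\<eta>. g (snd \<eta>) \<partial>borel_slice_measure \<tau>) =
     ennreal (r ^ (m + 1)) * (\<integral>\<^sup>+y. ennreal (sphere_area m * (1 / sqrt (1 + y\<^sup>2)) ^ (m + 2)) *
       g ((t\<^sup>2 + y / sqrt (1 + y\<^sup>2)) / (1 + t\<^sup>2)) \<partial>lborel)"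
    unfolding M
  proof (rule nn_integral_borel_sphere_measure_axial
      [OF V dim uV u1, where \<gamma> = "\<lambda>z. g ((t\<^sup>2 + z) / (1 + t\<^sup>2))"])
    show "g (snd (c + r *\<^sub>R sgn x)) = g ((t\<^sup>2 + u \<bullet> x / norm x) / (1 + t\<^sup>2))" if "x \<in> V" for x
      unfolding height[OF that] hx ..
  qed (use r(1) in simp_all)
  also have "\<dots> = (\<integral>\<^sup>+s. ennreal (slice_density (m + 2) t s) * indicator {t<..} s * g ((s\<^sup>2 - 1) / (s\<^sup>2 + 1)) \<partial>lborel)"
    unfolding tr(1) using t(1) g by (rule nn_integral_stereographic)
  finally show "(\<integral>\<^sup>+\<eta>. g (snd \<eta>) \<partial>borel_slice_measure \<tau>) =
     (\<integral>\<^sup>+s. ennreal (slice_density k t s) * indicator {t<..} s * g ((s\<^sup>2 - 1) / (s\<^sup>2 + 1)) \<partial>lborel)"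
    unfolding m .
qed

section \<open>Completed measures and their images\<close>

lemma compact_exhaustion_of_measure:
  fixes M :: "'a::{second_countable_topology, complete_space} measure"
  assumes M: "sets M = sets borel" "emeasure M (space M) \<noteq> \<infinity>" and S: "S \<in> sets borel"
  shows "\<exists>K :: nat \<Rightarrow> 'a set. (\<forall>i. compact (K i) \<and> K i \<subseteq> S) \<and> emeasure M (\<Union>i. K i) = emeasure M S"
proof -
  let ?E = "emeasure M ` {K. K \<subseteq> S \<and> compact K}"
  have "?E \<noteq> {}" by auto
  from ennreal_Sup_countable_SUP[OF this] obtain f :: "nat \<Rightarrow> ennreal"
    where f: "range f \<subseteq> ?E" "Sup ?E = (SUP i. f i)" by auto
  have "\<forall>i. \<exists>K. K \<subseteq> S \<and> compact K \<and> f i = emeasure M K"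
    using f(1) by (auto simp: subset_eq image_iff)
  then obtain K where K: "\<And>i. K i \<subseteq> S" "\<And>i. compact (K i)" "\<And>i. f i = emeasure M (K i)"
    by metis
  have "K i \<in> sets M" for i
    unfolding M(1) by (intro borel_closed compact_imp_closed K(2))
  then have meas: "(\<Union>i. K i) \<in> sets M" "S \<in> sets M"
    using S M(1) by auto
  have "emeasure M S = (SUP i. emeasure M (K i))"
    using inner_regular[OF M S] f(2) K(3) by simp
  also have "\<dots> \<le> emeasure M (\<Union>i. K i)"
    using meas by (intro SUP_least emeasure_mono) auto
  finally have "emeasure M S \<le> emeasure M (\<Union>i. K i)" .
  moreover have "emeasure M (\<Union>i. K i) \<le> emeasure M S"
    using meas K(1) by (intro emeasure_mono) auto
  ultimately show ?thesis using K(1,2) by (intro exI[of _ K]) auto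
qed

text \<open>
  Measurability of a preimage passes down to the set itself: \<open>E\<close> and its complement are filled up to null
  sets by images of compact sets, because the preimages are so filled by compact sets.  Images
  of compact sets under the continuous map \<open>p\<close> are compact, hence Borel.
\<close>
lemma sets_completion_distr_if_vimage:
  fixes M :: "'a::{second_countable_topology, complete_space} measure"
    and p :: "'a \<Rightarrow> 'b::t2_space"
  assumes M: "sets M = sets borel" "emeasure M (space M) \<noteq> \<infinity>"
    and p: "continuous_on UNIV p" and E: "p -` E \<in> sets (completion M)"
  shows "E \<in> sets (completion (distr M borel p))"
proof -
  have sp: "space M = UNIV" using sets_eq_imp_space_eq[OF M(1)] by simp
  have pm [measurable]: "p \<in> M \<rightarrow>\<^sub>M borel"
    using borel_measurable_continuous_onI[OF p] by (simp add: measurable_cong_sets[OF M(1) refl])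
  interpret finite_measure M using M(2) by (intro finite_measureI) simp
  have inner: "\<exists>A\<in>sets borel. A \<subseteq> D \<and> emeasure M (p -` A) = emeasure (completion M) (p -` D)"
    if D: "p -` D \<in> sets (completion M)" for D
  proof -
    let ?S = "main_part M (p -` D)"
    have S: "?S \<in> sets borel" "?S \<subseteq> p -` D" "emeasure M ?S = emeasure (completion M) (p -` D)"
      using main_part_sets[OF D] D M(1) main_part_null_part_Un[OF D] by (simp, blast, simp)
    obtain K :: "nat \<Rightarrow> 'a set"
      where "(\<forall>i. compact (K i) \<and> K i \<subseteq> ?S) \<and> emeasure M (\<Union>i. K i) = emeasure M ?S"
      using compact_exhaustion_of_measure[OF M S(1)] ..
    then have K: "compact (K i)" "K i \<subseteq> ?S" "emeasure M (\<Union>i. K i) = emeasure M ?S" for i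
      by auto
    define A where "A = (\<Union>i::nat. p ` K i)"
    have A: "A \<in> sets borel"
      unfolding A_def using K(1) continuous_on_subset[OF p]
      by (intro sets.countable_UN image_subsetI borel_closed compact_imp_closed compact_continuous_image) auto
    have AD: "A \<subseteq> D" unfolding A_def using K(2) S(2) by blast
    have pA: "p -` A \<in> sets M" using measurable_sets[OF pm A] sp by simp
    have "emeasure M (p -` A) \<le> emeasure (completion M) (p -` D)"
      using AD pA D emeasure_mono[of "p -` A" "p -` D" "completion M"] by (auto simp: vimage_mono)
    moreover have "emeasure M (\<Union>i. K i) \<le> emeasure M (p -` A)"
      using pA unfolding A_def by (intro emeasure_mono) auto
    ultimately show ?thesis using A AD K(3) S(3) by (intro bexI[of _ A]) auto
  qed
  obtain A where A: "A \<in> sets borel" "A \<subseteq> E" "emeasure M (p -` A) = emeasure (completion M) (p -` E)"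
    using inner[OF E] by blast
  have E': "p -` (- E) \<in> sets (completion M)"
    using sets.compl_sets[OF E] sp by (simp add: vimage_Diff Compl_eq_Diff_UNIV)
  obtain C where C: "C \<in> sets borel" "C \<subseteq> - E" "emeasure M (p -` C) = emeasure (completion M) (p -` (- E))"
    using inner[OF E'] by blast
  have AC: "p -` A \<in> sets M" "p -` C \<in> sets M"
    using measurable_sets[OF pm A(1)] measurable_sets[OF pm C(1)] sp by auto
  have "emeasure M (p -` (A \<union> C)) = emeasure M (p -` A) + emeasure M (p -` C)"
    using AC A(2) C(2) by (subst plus_emeasure) (auto simp: vimage_Un)
  also have "\<dots> = emeasure (completion M) (p -` E \<union> p -` (- E))"
    unfolding A(3) C(3) using E E' by (intro plus_emeasure) auto
  also have "p -` E \<union> p -` (- E) = space M" using sp by auto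
  finally have "emeasure M (p -` (A \<union> C)) = emeasure M (space M)" by simp
  then have "emeasure M (space M - p -` (A \<union> C)) = 0"
    using AC M(2) by (subst emeasure_compl) (auto simp: vimage_Un)
  then have "- (A \<union> C) \<in> null_sets (distr M borel p)"
    using A(1) C(1) sp
    by (auto simp: null_sets_def emeasure_distr vimage_Compl Compl_eq_Diff_UNIV vimage_Diff)
  then have "E - A \<in> sets (completion (distr M borel p))"
    by (rule sets_completionI_sub) (use C(2) in auto)
  moreover have "A \<in> sets (completion (distr M borel p))" using A(1) by auto
  ultimately have "(E - A) \<union> A \<in> sets (completion (distr M borel p))" by (rule sets.Un)
  moreover have "(E - A) \<union> A = E" using A(2) by auto
  ultimately show ?thesis by simp
qed

lemma (in complete_measure) measurable_if_AE_eq: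
  fixes f g :: "'a \<Rightarrow> 'b::topological_space"
  assumes g: "g \<in> borel_measurable M" and ae: "AE x in M. f x = g x"
  shows "f \<in> borel_measurable M"
proof (rule borel_measurableI)
  fix U :: "'b set" assume "open U"
  then have "g -` U \<inter> space M \<in> sets M" using g by (intro measurable_sets) auto
  then show "f -` U \<inter> space M \<in> sets M"
    by (rule in_sets_AE[rotated]) (use ae AE_space in \<open>auto elim: eventually_elim2\<close>)
qed

text \<open>
  An image law with a density pulls Lebesgue null sets back to null sets, so it extends to Lebesgue
  measurable sets.
\<close>
lemma distr_completion_density:
  fixes w :: "real \<Rightarrow> ennreal"
  assumes T [measurable]: "T \<in> M \<rightarrow>\<^sub>M borel" and w [measurable]: "w \<in> borel_measurable borel"
    and eq: "distr M borel T = density lborel w"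
  shows "T \<in> completion M \<rightarrow>\<^sub>M lebesgue"
    and "distr (completion M) lebesgue T = density lebesgue w"
proof -
  have null: "T -` N \<inter> space M \<in> null_sets M" if N: "N \<in> null_sets lborel" for N
  proof -
    have Nb: "N \<in> sets borel" using N by auto
    have "emeasure M (T -` N \<inter> space M) = emeasure (density lborel w) N"
      using Nb by (simp add: eq[symmetric] emeasure_distr)
    also have "\<dots> = 0"
      using N absolutely_continuousI_density[of w lborel] by (auto simp: absolutely_continuous_def)
    finally show ?thesis using measurable_sets[OF T Nb] by auto
  qed
  have T': "T \<in> completion M \<rightarrow>\<^sub>M lborel"
    using measurable_completion[OF T] by simp
  show TM [measurable]: "T \<in> completion M \<rightarrow>\<^sub>M lebesgue"
  proof (rule completion.measurable_completion2[OF T'], rule subsetI)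
    fix N assume N: "N \<in> null_sets (lborel :: real measure)"
    then have "T -` N \<inter> space M \<in> null_sets (completion M)"
      using null by (blast intro: null_sets_completionI)
    then show "N \<in> null_sets (distr (completion M) lborel T)"
      using N T' by (auto simp: null_sets_def emeasure_distr)
  qed
  show "distr (completion M) lebesgue T = density lebesgue w"
  proof (rule measure_eqI)
    fix A assume "A \<in> sets (distr (completion M) lebesgue T)"
    then have A: "A \<in> sets lebesgue" by simp
    define B where "B = main_part lborel A"
    have B: "B \<in> sets borel" using main_part_sets[OF A] by (simp add: B_def)
    have AB: "AE x in lborel. x \<in> B \<longleftrightarrow> x \<in> A" unfolding B_def by (rule AE_in_main_part[OF A])
    then obtain N where N: "N \<in> null_sets lborel" "{x. (x \<in> B) \<noteq> (x \<in> A)} \<subseteq> N"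
      by (auto simp: eventually_ae_filter)
    have AEM: "AE \<eta> in completion M. (T \<eta> \<in> A) = (T \<eta> \<in> B)"
      using AE_not_in[OF null_sets_completionI[OF null[OF N(1)]]] AE_space
      by eventually_elim (use N(2) in auto)
    have "emeasure (distr (completion M) lebesgue T) A = emeasure (completion M) (T -` A \<inter> space M)"
      using A by (subst emeasure_distr) simp_all
    also have "\<dots> = emeasure (completion M) (T -` B \<inter> space M)"
      using AEM A measurable_sets[OF TM, of A] measurable_sets[OF T B]
      by (intro emeasure_eq_AE) auto
    also have "\<dots> = emeasure (distr M borel T) B"
      using B by (simp add: emeasure_distr)
    also have "\<dots> = (\<integral>\<^sup>+x. w x * indicator B x \<partial>lborel)"
      unfolding eq using B by (subst emeasure_density) simp_all
    also have "\<dots> = (\<integral>\<^sup>+x. w x * indicator B x \<partial>lebesgue)"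
      by (simp add: nn_integral_completion)
    also have "\<dots> = (\<integral>\<^sup>+x. w x * indicator A x \<partial>lebesgue)"
      using AE_completion[OF AB] by (intro nn_integral_cong_AE) (auto elim!: eventually_mono simp: indicator_def)
    also have "\<dots> = emeasure (density lebesgue w) A"
      using A by (subst emeasure_density) (auto intro!: measurable_completion)
    finally show "emeasure (distr (completion M) lebesgue T) A = emeasure (density lebesgue w) A" .
  qed simp
qed

section \<open>The variable cot (\<phi> / 2) on a slice\<close>

text \<open>
  Since \<open>snd \<eta> = cos \<phi>\<close> on the sphere, this is \<open>cot (\<phi> / 2)\<close>, with the default value \<open>0\<close> at the north pole.
\<close>
definition cot_half_angle :: "(real^'n) \<times> real \<Rightarrow> real" where
  "cot_half_angle \<eta> = sqrt ((1 + snd \<eta>) / (1 - snd \<eta>))"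

lemma measurable_cot_half_angle [measurable]: "cot_half_angle \<in> borel_measurable borel"
  unfolding cot_half_angle_def by measurable

text \<open>
  At the south pole \<open>sin \<phi> = 0\<close>, and any unit vector serves as \<open>\<omega>\<close>.
\<close>
lemma sphere_point_polar:
  fixes \<eta> :: "(real^'n) \<times> real"
  assumes "\<eta> \<in> sphere 0 1" and "snd \<eta> \<noteq> 1"
  obtains \<omega> \<phi> where "norm \<omega> = 1" "0 < \<phi>" "\<phi> \<le> pi" "\<eta> = (sin \<phi> *\<^sub>R \<omega>, cos \<phi>)"
    "cot (\<phi> / 2) = cot_half_angle \<eta>"
proof -
  define h where "h = snd \<eta>"
  have n: "(norm (fst \<eta>))\<^sup>2 + h\<^sup>2 = 1"
    using assms(1) by (simp add: norm_prod_def h_def)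
  then have "h\<^sup>2 \<le> 1" by (metis add_increasing zero_le_power2 order_refl)
  then have h: "-1 \<le> h" "h < 1" using assms(2) by (auto simp: abs_square_le_1 h_def abs_le_iff)
  define \<phi> where "\<phi> = arccos h"
  have cos: "cos \<phi> = h" and \<phi>: "0 < \<phi>" "\<phi> \<le> pi"
    using h arccos_less_arccos[of h 1] arccos_ubound[of h] by (simp_all add: \<phi>_def)
  have sin: "sin \<phi> = norm (fst \<eta>)"
  proof -
    have "sin \<phi> = sqrt (1 - h\<^sup>2)" using h by (simp add: \<phi>_def sin_arccos)
    also have "1 - h\<^sup>2 = (norm (fst \<eta>))\<^sup>2" using n by simp
    finally show ?thesis by simp
  qed
  define \<omega> where "\<omega> = (if fst \<eta> = 0 then axis undefined 1 else sgn (fst \<eta>))"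
  have "norm \<omega> = 1" by (simp add: \<omega>_def norm_axis_1 norm_sgn)
  moreover have "sin \<phi> *\<^sub>R \<omega> = fst \<eta>" by (simp add: \<omega>_def sin sgn_div_norm)
  then have "\<eta> = (sin \<phi> *\<^sub>R \<omega>, cos \<phi>)" by (simp add: cos h_def)
  moreover have "cot (\<phi> / 2) = cot_half_angle \<eta>"
  proof -
    have c: "cos (\<phi> / 2) \<ge> 0" "sin (\<phi> / 2) > 0"
      using \<phi> by (auto intro!: cos_ge_zero sin_gt_zero)
    have "1 + h = 2 * (cos (\<phi> / 2))\<^sup>2" "1 - h = 2 * (sin (\<phi> / 2))\<^sup>2"
      using cos_double_cos[of "\<phi> / 2"] cos_double_sin[of "\<phi> / 2"] cos by (auto)
    then have "(1 + h) / (1 - h) = (cot (\<phi> / 2))\<^sup>2" by (simp add: cot_def power_divide)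
    then show ?thesis
      using c by (simp add: cot_half_angle_def h_def cot_def)
  qed
  ultimately show ?thesis using that \<phi> by blast
qed

definition slice_weight :: "nat \<Rightarrow> real \<Rightarrow> real \<Rightarrow> real" where
  "slice_weight k t s = slice_density k t s * indicator {t<..} s"

lemma slice_weight_nonneg: "0 \<le> t \<Longrightarrow> 0 \<le> slice_weight k t s"
  by (auto simp: slice_weight_def slice_density_def sphere_area_def indicator_def
      intro!: mult_nonneg_nonneg divide_nonneg_nonneg)

lemma measurable_slice_weight [measurable]: "slice_weight k t \<in> borel_measurable borel"
  unfolding slice_weight_def by measurable

lemma
  fixes \<tau> :: "((real^'n) \<times> real) set"
  assumes \<tau>: "\<tau> \<in> slice_planes k" and k: "2 \<le> k"
  defines "t \<equiv> infdist 0 \<tau> / sqrt (1 - (infdist 0 \<tau>)\<^sup>2)"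
  shows distr_slice_cot_half_angle:
      "distr (borel_slice_measure \<tau>) borel cot_half_angle = density lborel (slice_weight k t)"
    and AE_slice_generic:
      "AE \<eta> in borel_slice_measure \<tau>. \<eta> \<in> sphere 0 1 \<and> snd \<eta> \<noteq> 1 \<and> 0 < cot_half_angle \<eta>"
    and slice_parameter_nonneg: "0 \<le> t"
proof -
  note height = nn_integral_slice_height[OF \<tau> k, folded t_def]
  show t: "0 \<le> t"
    using slice_eq_sphere(1)[OF \<tau>] infdist_nonneg[of 0 \<tau>]
    by (auto simp: t_def abs_square_le_1 intro!: divide_nonneg_nonneg)
  have cot: "sqrt ((1 + (s\<^sup>2 - 1) / (s\<^sup>2 + 1)) / (1 - (s\<^sup>2 - 1) / (s\<^sup>2 + 1))) = s" if "s > t" for s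
  proof -
    have "s\<^sup>2 + 1 > 0" by (simp add: add_nonneg_pos)
    then have "1 + (s\<^sup>2 - 1) / (s\<^sup>2 + 1) = 2 * s\<^sup>2 / (s\<^sup>2 + 1)" "1 - (s\<^sup>2 - 1) / (s\<^sup>2 + 1) = 2 / (s\<^sup>2 + 1)"
      by (auto simp: field_simps)
    then show ?thesis using \<open>s\<^sup>2 + 1 > 0\<close> that t by simp
  qed
  have w: "ennreal (slice_density k t s) * indicator {t<..} s = ennreal (slice_weight k t s)" for s
    by (simp add: slice_weight_def indicator_def)
  show "distr (borel_slice_measure \<tau>) borel cot_half_angle = density lborel (slice_weight k t)"
  proof (rule measure_eqI)
    fix X assume "X \<in> sets (distr (borel_slice_measure \<tau>) borel cot_half_angle)"
    then have X [measurable]: "X \<in> sets borel" by simp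
    let ?g = "\<lambda>h. indicator X (sqrt ((1 + h) / (1 - h))) :: ennreal"
    have "emeasure (distr (borel_slice_measure \<tau>) borel cot_half_angle) X =
          (\<integral>\<^sup>+\<eta>. indicator X (cot_half_angle \<eta>) \<partial>borel_slice_measure \<tau>)"
      by (subst nn_integral_indicator[symmetric], simp, subst nn_integral_distr) simp_all
    also have "\<dots> = (\<integral>\<^sup>+\<eta>. ?g (snd \<eta>) \<partial>borel_slice_measure \<tau>)"
      by (simp add: cot_half_angle_def)
    also have "\<dots> = (\<integral>\<^sup>+s. ennreal (slice_weight k t s) * ?g ((s\<^sup>2 - 1) / (s\<^sup>2 + 1)) \<partial>lborel)"
      unfolding w[symmetric] by (rule height(1)) measurable
    also have "\<dots> = (\<integral>\<^sup>+s. ennreal (slice_weight k t s) * indicator X s \<partial>lborel)"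
    proof (rule nn_integral_cong)
      fix s
      show "ennreal (slice_weight k t s) * ?g ((s\<^sup>2 - 1) / (s\<^sup>2 + 1)) = ennreal (slice_weight k t s) * indicator X s"
        by (cases "s > t") (simp_all only: cot, simp add: slice_weight_def)
    qed
    also have "\<dots> = emeasure (density lborel (slice_weight k t)) X"
      by (subst emeasure_density) simp_all
    finally show "emeasure (distr (borel_slice_measure \<tau>) borel cot_half_angle) X =
                  emeasure (density lborel (slice_weight k t)) X" .
  qed simp
  have "(\<integral>\<^sup>+\<eta>. indicator {1} (snd \<eta>) \<partial>borel_slice_measure \<tau>) =
        (\<integral>\<^sup>+s. ennreal (slice_density k t s) * indicator {t<..} s * indicator {1} ((s\<^sup>2 - 1) / (s\<^sup>2 + 1)) \<partial>lborel)"
    by (rule height(1)) simp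
  also have "\<dots> = (\<integral>\<^sup>+s. 0 \<partial>(lborel :: real measure))"
  proof (rule nn_integral_cong)
    fix s :: real
    have "s\<^sup>2 + 1 > 0" by (simp add: add_nonneg_pos)
    then have "(s\<^sup>2 - 1) / (s\<^sup>2 + 1) \<noteq> 1" by (simp add: field_simps)
    then show "ennreal (slice_density k t s) * indicator {t<..} s * indicator {1} ((s\<^sup>2 - 1) / (s\<^sup>2 + 1)) = 0"
      by simp
  qed
  finally have "AE \<eta> in borel_slice_measure \<tau>. snd \<eta> \<noteq> 1"
    by (simp add: nn_integral_0_iff_AE indicator_def split: if_splits)
  moreover have "AE s in density lborel (slice_weight k t). 0 < s"
    using t by (subst AE_density) (auto simp: slice_weight_def indicator_def)
  then have "AE \<eta> in borel_slice_measure \<tau>. 0 < cot_half_angle \<eta>"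
    unfolding \<open>distr (borel_slice_measure \<tau>) borel cot_half_angle = density lborel (slice_weight k t)\<close>[symmetric]
    by (subst (asm) AE_distr_iff) simp_all
  ultimately show "AE \<eta> in borel_slice_measure \<tau>. \<eta> \<in> sphere 0 1 \<and> snd \<eta> \<noteq> 1 \<and> 0 < cot_half_angle \<eta>"
    using height(2) by eventually_elim auto
qed

section \<open>Almost everywhere convergence of the Abel integral\<close>

lemma nn_integral_powr_from_0_reflected:
  fixes a s :: real
  assumes "a > -1" "s > 0"
  shows "(\<integral>\<^sup>+t. ennreal ((s - t) powr a) * indicator {0<..<s} t \<partial>lborel) = ennreal (s powr (a + 1) / (a + 1))"
proof -
  have "(\<integral>\<^sup>+t. ennreal ((s - t) powr a) * indicator {0<..<s} t \<partial>lborel) =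
        (\<integral>\<^sup>+x. ennreal (x powr a) * indicator {0<..<s} x \<partial>lborel)"
    by (subst nn_integral_real_affine[of _ "-1" s]) (auto simp: indicator_def intro!: nn_integral_cong)
  also have "\<dots> = (\<integral>\<^sup>+x. ennreal (indicator {0..s} x * x powr a) \<partial>lborel)"
    by (intro nn_integral_cong_AE, use AE_lborel_singleton[of 0] AE_lborel_singleton[of s] in eventually_elim)
       (auto simp: indicator_def)
  also have "\<dots> = ennreal (s powr (a + 1) / (a + 1))"
    using has_integral_powr_from_0[of a s] assms
    by (intro nn_integral_has_integral_lebesgue) auto
  finally show ?thesis .
qed

text \<open>
  For \<open>k \<ge> 3\<close> the kernel is at most \<open>s\<^sup>k\<^sup>-\<^sup>3\<close>.  For \<open>k = 2\<close> it is singular at \<open>t = s\<close>: if \<open>s \<le> 2 b\<close>, the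
  estimate \<open>s\<^sup>2 - t\<^sup>2 \<ge> s (s - t)\<close> bounds the integral by \<open>2\<close>; if \<open>s > 2 b\<close>, the range of \<open>t\<close> stays away
  from \<open>s\<close> and the kernel is at most \<open>2 / s\<close>.
\<close>
lemma abel_kernel_bound:
  fixes b s :: real
  assumes k: "2 \<le> k" and b: "0 < b" and s: "0 < s"
  shows "ennreal s * (\<integral>\<^sup>+t. ennreal ((s\<^sup>2 - t\<^sup>2) powr ((real k - 3) / 2)) * indicator {0<..<min b s} t \<partial>lborel)
         \<le> ennreal (4 * b * s ^ (k - 2))"
proof -
  let ?I = "\<integral>\<^sup>+t. ennreal ((s\<^sup>2 - t\<^sup>2) powr ((real k - 3) / 2)) * indicator {0<..<min b s} t \<partial>lborel"
  have const: "?I \<le> ennreal (c * b)"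
    if "c \<ge> 0" "\<And>t. 0 < t \<Longrightarrow> t < b \<Longrightarrow> t < s \<Longrightarrow> (s\<^sup>2 - t\<^sup>2) powr ((real k - 3) / 2) \<le> c" for c
  proof -
    have "?I \<le> (\<integral>\<^sup>+t. ennreal c * indicator {0<..<b} t \<partial>lborel)"
      using that by (intro nn_integral_mono) (auto simp: indicator_def intro!: ennreal_leI)
    also have "\<dots> = ennreal (c * b)"
      using b that by (simp add: nn_integral_cmult_indicator ennreal_mult)
    finally show ?thesis .
  qed
  have "?I \<le> ennreal (4 * b * s ^ (k - 2) / s)"
  proof (cases "k = 2")
    case k2: True
    show ?thesis
    proof (cases "s \<le> 2 * b")
      case True
      have "?I \<le> (\<integral>\<^sup>+t. ennreal (s powr (-1/2)) * (ennreal ((s - t) powr (-1/2)) * indicator {0<..<s} t) \<partial>lborel)"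
      proof (rule nn_integral_mono)
        fix t
        have "(s\<^sup>2 - t\<^sup>2) powr (-1/2) \<le> s powr (-1/2) * (s - t) powr (-1/2)" if t: "0 < t" "t < s"
        proof -
          have "s * (s - t) \<le> s\<^sup>2 - t\<^sup>2"
            using t by (simp add: power2_eq_square algebra_simps mult_left_mono)
          then have "(s\<^sup>2 - t\<^sup>2) powr (-1/2) \<le> (s * (s - t)) powr (-1/2)"
            using t by (intro powr_mono2') auto
          then show ?thesis using t by (simp add: powr_mult)
        qed
        then show "ennreal ((s\<^sup>2 - t\<^sup>2) powr ((real k - 3) / 2)) * indicator {0<..<min b s} t \<le>
           ennreal (s powr (-1/2)) * (ennreal ((s - t) powr (-1/2)) * indicator {0<..<s} t)"
          using k2 by (auto simp: indicator_def ennreal_mult[symmetric] intro!: ennreal_leI)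
      qed
      also have "\<dots> = ennreal (s powr (-1/2)) * ennreal (s powr (1/2) / (1/2))"
        using nn_integral_powr_from_0_reflected[of "-1/2" s] s by (subst nn_integral_cmult) auto
      also have "\<dots> = ennreal 2"
      proof -
        have "s powr (-1/2) * s powr (1/2) = 1" using s by (subst powr_add[symmetric]) simp
        then show ?thesis using s by (simp add: ennreal_mult[symmetric] mult.assoc[symmetric])
      qed
      also have "\<dots> \<le> ennreal (4 * b * s ^ (k - 2) / s)"
        using s True k2 by (intro ennreal_leI) (simp add: field_simps)
      finally show ?thesis .
    next
      case False
      have "(s\<^sup>2 - t\<^sup>2) powr ((real k - 3) / 2) \<le> 2 / s" if t: "0 < t" "t < b" for t
      proof -
        have "t * t \<le> (s / 2) * (s / 2)" using t False by (intro mult_mono) auto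
        then have "t\<^sup>2 \<le> (s / 2)\<^sup>2" by (simp only: power2_eq_square)
        moreover have "(s / 2)\<^sup>2 = s\<^sup>2 / 4" by (simp add: power_divide)
        ultimately have le: "(s / 2)\<^sup>2 \<le> s\<^sup>2 - t\<^sup>2" using zero_le_power2[of s] by linarith
        have "(s\<^sup>2 - t\<^sup>2) powr (-1/2) \<le> ((s / 2)\<^sup>2) powr (-1/2)"
          using le s by (intro powr_mono2') auto
        also have "\<dots> = 2 / s"
          using s by (simp add: powr_minus_divide powr_half_sqrt)
        finally show ?thesis using k2 by simp
      qed
      then have "?I \<le> ennreal (2 / s * b)" using s by (intro const) auto
      also have "\<dots> \<le> ennreal (4 * b * s ^ (k - 2) / s)"
        using s b k2 by (intro ennreal_leI) (simp add: field_simps)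
      finally show ?thesis .
    qed
  next
    case False
    then have k3: "k \<ge> 3" using k by simp
    have "(s\<^sup>2 - t\<^sup>2) powr ((real k - 3) / 2) \<le> s ^ (k - 2) / s" if t: "0 < t" "t < s" for t
    proof -
      have "(s\<^sup>2 - t\<^sup>2) powr ((real k - 3) / 2) \<le> (s\<^sup>2) powr ((real k - 3) / 2)"
        using t k3 power_strict_mono[of t s 2] by (intro powr_mono2) auto
      also have "\<dots> = s powr (real (k - 3))"
      proof -
        have "(s\<^sup>2) powr ((real k - 3) / 2) = (s powr 2) powr ((real k - 3) / 2)"
          using s by (simp add: powr_numeral)
        also have "\<dots> = s powr (real (k - 3))" using k3 by (simp only: powr_powr) (simp add: of_nat_diff diff_divide_distrib)
        finally show ?thesis .
      qed
      also have "\<dots> = s ^ (k - 3)" using s by (rule powr_realpow)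
      also have "\<dots> = s ^ (k - 2) / s"
      proof -
        have "k - 2 = Suc (k - 3)" using k3 by simp
        then show ?thesis using s by simp
      qed
      finally show ?thesis .
    qed
    then have "?I \<le> ennreal (s ^ (k - 2) / s * b)" using s by (intro const) auto
    also have "\<dots> \<le> ennreal (4 * b * s ^ (k - 2) / s)"
      using s b by (intro ennreal_leI) (simp add: field_simps)
    finally show ?thesis .
  qed
  then have "ennreal s * ?I \<le> ennreal s * ennreal (4 * b * s ^ (k - 2) / s)"
    by (intro mult_left_mono) auto
  also have "\<dots> = ennreal (4 * b * s ^ (k - 2))"
    using s b by (simp add: ennreal_mult[symmetric])
  finally show ?thesis .
qed

text \<open>
  Countably many intervals \<open>{a<..<b}\<close> with \<open>0 < a\<close> cover the half-line, and by Tonelli and the bound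
  for the kernel the integral over \<open>t\<close> in each of them of the Abel integral is finite.
\<close>
lemma AE_abel_integral_finite:
  fixes N :: "real \<Rightarrow> ennreal"
  assumes k: "2 \<le> k" and N [measurable]: "N \<in> borel_measurable borel"
    and fin: "\<And>a. 0 < a \<Longrightarrow> (\<integral>\<^sup>+s. N s * ennreal (s ^ (k - 2) / (1 + s\<^sup>2) ^ (k - 1)) * indicator {a<..} s \<partial>lborel) < \<infinity>"
  shows "AE t in lborel. 0 < t \<longrightarrow>
     (\<integral>\<^sup>+s. N s * ennreal ((s\<^sup>2 - t\<^sup>2) powr ((real k - 3) / 2) * s / (1 + s\<^sup>2) ^ (k - 1)) *
        indicator {t<..} s \<partial>lborel) < \<infinity>"
proof -
  define J where "J t s = N s * ennreal ((s\<^sup>2 - t\<^sup>2) powr ((real k - 3) / 2) * s / (1 + s\<^sup>2) ^ (k - 1)) *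
     indicator {t<..} s" for t s
  have J [measurable]: "case_prod J \<in> borel_measurable (borel \<Otimes>\<^sub>M borel)"
    unfolding J_def greaterThan_def by measurable
  have fin_ab: "AE t in lborel. t \<in> {a<..<b} \<longrightarrow> (\<integral>\<^sup>+s. J t s \<partial>lborel) < \<infinity>" if ab: "0 < a" "a < b" for a b
  proof -
    have b: "0 < b" using ab by simp
    let ?L = "\<lambda>s. N s * ennreal (s ^ (k - 2) / (1 + s\<^sup>2) ^ (k - 1)) * indicator {a<..} s"
    let ?k = "\<lambda>t s. ennreal ((s\<^sup>2 - t\<^sup>2) powr ((real k - 3) / 2)) * indicator {0<..<min b s} t"
    have "(\<integral>\<^sup>+t. \<integral>\<^sup>+s. indicator {a<..<b} t * J t s \<partial>lborel \<partial>lborel) =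
          (\<integral>\<^sup>+s. \<integral>\<^sup>+t. indicator {a<..<b} t * J t s \<partial>lborel \<partial>lborel)"
      by (rule nn_integral_lborel_swap) measurable
    also have "\<dots> \<le> (\<integral>\<^sup>+s. ennreal (4 * b) * ?L s \<partial>lborel)"
    proof (rule nn_integral_mono)
      fix s :: real
      show "(\<integral>\<^sup>+t. indicator {a<..<b} t * J t s \<partial>lborel) \<le> ennreal (4 * b) * ?L s"
      proof (cases "s > a")
        case True
        then have s: "s > 0" using ab by simp
        have Q: "(1 + s\<^sup>2) ^ (k - 1) > 0" by (simp add: add_pos_nonneg)
        let ?c = "N s * ennreal (1 / (1 + s\<^sup>2) ^ (k - 1)) * ennreal s"
        have "(\<integral>\<^sup>+t. indicator {a<..<b} t * J t s \<partial>lborel) \<le> (\<integral>\<^sup>+t. ?c * ?k t s \<partial>lborel)"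
        proof (rule nn_integral_mono)
          fix t
          have e: "ennreal (p * s / (1 + s\<^sup>2) ^ (k - 1)) = ennreal (1 / (1 + s\<^sup>2) ^ (k - 1)) * ennreal s * ennreal p"
            if "p \<ge> 0" for p
            using s Q that by (simp add: ennreal_mult[symmetric])
          show "indicator {a<..<b} t * J t s \<le> ?c * ?k t s"
            unfolding J_def using ab by (subst e) (auto simp: indicator_def mult.assoc)
        qed
        also have "\<dots> = N s * ennreal (1 / (1 + s\<^sup>2) ^ (k - 1)) * (ennreal s * (\<integral>\<^sup>+t. ?k t s \<partial>lborel))"
          by (subst nn_integral_cmult) (simp_all add: mult.assoc)
        also have "\<dots> \<le> N s * ennreal (1 / (1 + s\<^sup>2) ^ (k - 1)) * ennreal (4 * b * s ^ (k - 2))"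
          by (intro mult_left_mono abel_kernel_bound k b s) simp
        also have "\<dots> = N s * ennreal (4 * b * (s ^ (k - 2) / (1 + s\<^sup>2) ^ (k - 1)))"
          using s Q b by (simp add: mult.assoc ennreal_mult[symmetric])
        also have "\<dots> = ennreal (4 * b) * ?L s"
          using True s Q b by (subst ennreal_mult) (auto simp: ac_simps)
        finally show ?thesis .
      next
        case False
        have "(\<integral>\<^sup>+t. indicator {a<..<b} t * J t s \<partial>lborel) = (\<integral>\<^sup>+t. 0 \<partial>(lborel :: real measure))"
          using False by (intro nn_integral_cong) (auto simp: J_def indicator_def)
        then show ?thesis by simp
      qed
    qed
    also have "\<dots> = ennreal (4 * b) * (\<integral>\<^sup>+s. ?L s \<partial>lborel)"
      by (subst nn_integral_cmult) simp_all
    also have "\<dots> < \<infinity>" using fin[OF ab(1)] by (simp add: ennreal_mult_less_top)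
    finally have "(\<integral>\<^sup>+t. \<integral>\<^sup>+s. indicator {a<..<b} t * J t s \<partial>lborel \<partial>lborel) \<noteq> \<infinity>" by simp
    then have "AE t in lborel. (\<integral>\<^sup>+s. indicator {a<..<b} t * J t s \<partial>lborel) \<noteq> \<infinity>"
      by (intro nn_integral_PInf_AE) simp_all
    then show ?thesis
      by (rule eventually_mono) (auto simp: less_top)
  qed
  have "AE t in lborel. \<forall>j::nat. t \<in> {inverse (real (Suc (Suc j)))<..<real (Suc j)} \<longrightarrow> (\<integral>\<^sup>+s. J t s \<partial>lborel) < \<infinity>"
    unfolding AE_all_countable
  proof (intro allI)
    fix j :: nat
    have "inverse (real (Suc (Suc j))) < 1" by (simp add: inverse_less_1_iff)
    then have "inverse (real (Suc (Suc j))) < real (Suc j)" by (rule less_le_trans) simp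
    then show "AE t in lborel. t \<in> {inverse (real (Suc (Suc j)))<..<real (Suc j)} \<longrightarrow>
        (\<integral>\<^sup>+s. J t s \<partial>lborel) < \<infinity>"
      by (rule fin_ab[rotated]) simp
  qed
  then show ?thesis
  proof (rule eventually_mono, intro impI)
    fix t :: real
    assume *: "\<forall>j::nat. t \<in> {inverse (real (Suc (Suc j)))<..<real (Suc j)} \<longrightarrow> (\<integral>\<^sup>+s. J t s \<partial>lborel) < \<infinity>"
      and t: "0 < t"
    obtain i where i: "inverse (real (Suc i)) < t" using reals_Archimedean[OF t] by auto
    obtain j where j: "t < real j" using reals_Archimedean2 by auto
    let ?m = "max i j"
    have "inverse (real (Suc (Suc ?m))) \<le> inverse (real (Suc i))" by (intro le_imp_inverse_le) auto
    then have "inverse (real (Suc (Suc ?m))) < t" using i by (rule le_less_trans)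
    then have "t \<in> {inverse (real (Suc (Suc ?m)))<..<real (Suc ?m)}" using j by simp
    from *[rule_format, OF this]
    show "(\<integral>\<^sup>+s. N s * ennreal ((s\<^sup>2 - t\<^sup>2) powr ((real k - 3) / 2) * s / (1 + s\<^sup>2) ^ (k - 1)) *
        indicator {t<..} s \<partial>lborel) < \<infinity>"
      unfolding J_def .
  qed
qed

section \<open>Zonal functions\<close>

text \<open>
  The whole sphere is the slice by the plane \<open>UNIV\<close>, with \<open>k = n + 1\<close> and \<open>t = 0\<close>; what is known for
  slices therefore applies to the measure in the hypotheses.
\<close>
lemma UNIV_in_slice_planes: "(UNIV :: ((real^'n) \<times> real) set) \<in> slice_planes (CARD('n) + 1)"
  by (auto simp: slice_planes_def aff_dim_UNIV intro: exI[of _ 0])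

lemma borel_slice_measure_UNIV:
  "borel_slice_measure (UNIV :: ((real^'n) \<times> real) set) = borel_sphere_measure UNIV 0 1"
proof -
  have "closest_point (UNIV :: ((real^'n) \<times> real) set) 0 = 0" by (simp add: closest_point_self)
  moreover have "infdist 0 (UNIV :: ((real^'n) \<times> real) set) = 0" by simp
  ultimately show ?thesis by (simp add: borel_slice_measure_def Let_def)
qed

lemma emeasure_borel_sphere_measure_finite:
  fixes V :: "'a::euclidean_space set"
  assumes "subspace V"
  shows "emeasure (borel_sphere_measure V c r) UNIV \<noteq> \<infinity>"
proof -
  have "emeasure (borel_sphere_measure V c r) UNIV = (\<integral>\<^sup>+\<eta>. 1 \<partial>borel_sphere_measure V c r)"
    by simp
  also have "\<dots> = ennreal (real (dim V) * r ^ (dim V - 1)) * emeasure (lborel_subspace V) (cball 0 1)"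
    by (subst nn_integral_borel_sphere_measure) (simp_all add: nn_integral_cmult_indicator)
  also have "\<dots> < \<infinity>"
    unfolding emeasure_lborel_subspace_unit_ball[OF assms] by (simp add: ennreal_mult_less_top)
  finally show ?thesis by simp
qed

text \<open>
  The profile is a function of the height, and the height is continuous, so that Lebesgue
  measurability of \<open>f\<close> descends to the law of the height.  As the density of the
  law of \<open>cot (\<phi> / 2)\<close> on the whole sphere is positive on the half-line, null sets of that law are Lebesgue
  null sets.
\<close>
lemma measurable_profile:
  fixes f :: "(real^'n) \<times> real \<Rightarrow> 'b::topological_space" and f0 :: "real \<Rightarrow> 'b"
  assumes f: "f \<in> borel_measurable (sphere_measure UNIV 0 1)"
    and f0: "\<And>\<eta>. \<eta> \<in> sphere 0 1 \<Longrightarrow> snd \<eta> \<noteq> 1 \<Longrightarrow> f \<eta> = f0 (cot_half_angle \<eta>)"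
  shows "(\<lambda>s. if 0 < s then f0 s else c) \<in> borel_measurable lebesgue"
proof (rule borel_measurableI)
  fix U :: "'b set" assume U: "open U"
  define n where "n = CARD('n)"
  define M where "M = borel_slice_measure (UNIV :: ((real^'n) \<times> real) set)"
  have n1: "n \<ge> 1" by (simp add: n_def Suc_leI)
  have pl: "(UNIV :: ((real^'n) \<times> real) set) \<in> slice_planes (n + 1)" "2 \<le> n + 1"
    using UNIV_in_slice_planes n1 by (auto simp: n_def)
  have M: "sets M = sets borel" "space M = UNIV" by (simp_all add: M_def)
  have fin: "emeasure M (space M) \<noteq> \<infinity>"
    unfolding M(2) unfolding M_def borel_slice_measure_UNIV
    by (rule emeasure_borel_sphere_measure_finite) simp
  have fM: "f \<in> borel_measurable (completion M)"
    using f by (simp add: M_def borel_slice_measure_UNIV sphere_measure_eq_completion)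
  define E where "E = {h. f0 (sqrt ((1 + h) / (1 - h))) \<in> U}"
  have "AE \<eta> in M. \<eta> \<in> sphere 0 1 \<and> snd \<eta> \<noteq> 1 \<and> 0 < cot_half_angle \<eta>"
    unfolding M_def by (rule AE_slice_generic[OF pl])
  then have "AE \<eta> in completion M. \<eta> \<in> sphere 0 1 \<and> snd \<eta> \<noteq> 1 \<and> 0 < cot_half_angle \<eta>"
    by (rule AE_completion)
  then have "AE \<eta> in completion M. \<eta> \<in> f -` U \<longleftrightarrow> \<eta> \<in> snd -` E"
    by eventually_elim (simp add: f0 E_def cot_half_angle_def)
  moreover have "f -` U \<in> sets (completion M)"
    using measurable_sets[OF fM, of U] U M(2) by simp
  ultimately have "snd -` E \<in> sets (completion M)"
    by (rule completion.in_sets_AE) (simp add: M(2))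
  then have "E \<in> sets (completion (distr M borel snd))"
    using fin by (intro sets_completion_distr_if_vimage M(1) continuous_intros)
  then obtain S N N' where SN: "E = S \<union> N" "N \<subseteq> N'" "N' \<in> null_sets (distr M borel snd)" "S \<in> sets borel"
    by (auto elim!: sets_completionE)
  define p where "p s = (s\<^sup>2 - 1) / (s\<^sup>2 + 1)" for s :: real
  have [measurable]: "p \<in> borel_measurable borel" "S \<in> sets borel" "N' \<in> sets borel"
    using SN by (auto simp: p_def[abs_def])
  have "(\<integral>\<^sup>+\<eta>. indicator N' (snd \<eta>) \<partial>M) = 0"
  proof -
    have "(\<integral>\<^sup>+\<eta>. indicator N' (snd \<eta>) \<partial>M) = emeasure (distr M borel snd) N'"
      using M(1) by (subst nn_integral_indicator[symmetric], simp, subst nn_integral_distr)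
        (simp_all add: measurable_cong_sets[OF M(1) refl])
    then show ?thesis using SN(3) by auto
  qed
  moreover have "(\<integral>\<^sup>+\<eta>. indicator N' (snd \<eta>) \<partial>M) =
     (\<integral>\<^sup>+s. ennreal (slice_density (n + 1) 0 s) * indicator {0<..} s * indicator N' (p s) \<partial>lborel)"
    using nn_integral_slice_height(1)[OF pl, of "indicator N'"] by (simp add: M_def p_def)
  ultimately have "(\<integral>\<^sup>+s. ennreal (slice_density (n + 1) 0 s) * indicator {0<..} s * indicator N' (p s) \<partial>lborel) = 0"
    by simp
  then have "AE s in lborel. ennreal (slice_density (n + 1) 0 s) * indicator {0<..} s * indicator N' (p s) = 0"
    by (subst (asm) nn_integral_0_iff_AE) simp_all
  then have ae: "AE s in lborel. 0 < s \<longrightarrow> p s \<notin> N'"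
  proof (rule eventually_mono, intro impI)
    fix s :: real
    assume z: "ennreal (slice_density (n + 1) 0 s) * indicator {0<..} s * indicator N' (p s) = 0" and s: "0 < s"
    have "slice_density (n + 1) 0 s > 0"
      unfolding slice_density_def using s sphere_area_pos[of "n + 1 - 2"]
      by (intro mult_pos_pos divide_pos_pos zero_less_power add_pos_nonneg) auto
    then show "p s \<notin> N'" using z s by (auto simp: indicator_def split: if_splits)
  qed
  have E: "p s \<in> E \<longleftrightarrow> f0 s \<in> U" if s: "0 < s" for s
  proof -
    have "s\<^sup>2 + 1 > 0" by (simp add: add_nonneg_pos)
    then have "(1 + p s) / (1 - p s) = s\<^sup>2" unfolding p_def by (simp add: field_simps)
    then show ?thesis using s by (simp add: E_def)
  qed
  define Q where "Q = {s. if 0 < s then p s \<in> S else c \<in> U}"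
  have "Q \<in> sets borel" unfolding Q_def by measurable
  then have Q: "Q \<in> sets lebesgue" by auto
  have "AE s in lebesgue. s \<in> Q \<longleftrightarrow> s \<in> (\<lambda>s. if 0 < s then f0 s else c) -` U"
    using AE_completion[OF ae]
  proof eventually_elim
    case (elim s)
    then show ?case using E[of s] SN(1,2) by (auto simp: Q_def)
  qed
  then have "(\<lambda>s. if 0 < s then f0 s else c) -` U \<in> sets lebesgue"
    using Q by (rule completion.in_sets_AE) simp
  then show "(\<lambda>s. if 0 < s then f0 s else c) -` U \<inter> space lebesgue \<in> sets lebesgue" by simp
qed

lemma integrable_scaleR_iff:
  fixes f :: "'a \<Rightarrow> 'b::{banach, second_countable_topology}"
  assumes "c \<noteq> 0"
  shows "integrable M (\<lambda>x. c *\<^sub>R f x) \<longleftrightarrow> integrable M f"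
  using integrable_scaleR_right[of "inverse c" M "\<lambda>x. c *\<^sub>R f x"] assms by auto

text \<open>
  Both integrals are integrals of the profile against the law of \<open>cot (\<phi> / 2)\<close>.  If the profile is not
  integrable, both have the default value \<open>0\<close>.
\<close>
lemma slice_transform_zonal:
  fixes f :: "(real^'n) \<times> real \<Rightarrow> 'b::{banach, second_countable_topology}"
  assumes \<tau>: "\<tau> \<in> slice_planes k" and k: "2 \<le> k"
    and f: "f \<in> borel_measurable (sphere_measure UNIV 0 1)"
    and f0: "\<And>\<eta>. \<eta> \<in> sphere 0 1 \<Longrightarrow> snd \<eta> \<noteq> 1 \<Longrightarrow> f \<eta> = f0 (cot_half_angle \<eta>)"
  defines "t \<equiv> infdist 0 \<tau> / sqrt (1 - (infdist 0 \<tau>)\<^sup>2)"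
  shows "integrable (slice_measure \<tau>) f \<longleftrightarrow> set_integrable lebesgue {t<..} (F0_integrand k f0 t)"
    and "slice_transform f \<tau> = F0 k f0 t"
proof -
  define F where "F = (\<lambda>s. if 0 < s then f0 s else 0)"
  define M where "M = borel_slice_measure \<tau>"
  define C where "C = 2 ^ (k - 1) * sphere_area (k - 2)"
  have C: "C \<noteq> 0" using sphere_area_pos[of "k - 2"] by (simp add: C_def)
  have F [measurable]: "F \<in> borel_measurable lebesgue"
    unfolding F_def using f f0 by (rule measurable_profile)
  note law = distr_slice_cot_half_angle[OF \<tau> k, folded t_def, folded M_def]
  have t: "0 \<le> t" unfolding t_def by (rule slice_parameter_nonneg[OF \<tau> k])
  have TM: "cot_half_angle \<in> M \<rightarrow>\<^sub>M borel" by (simp add: M_def)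
  note T = distr_completion_density[OF TM _ law]
  have T1 [measurable]: "cot_half_angle \<in> completion M \<rightarrow>\<^sub>M lebesgue" by (rule T(1)) simp
  have T2: "distr (completion M) lebesgue cot_half_angle = density lebesgue (slice_weight k t)"
    by (rule T(2)) simp
  have W [measurable]: "slice_weight k t \<in> borel_measurable lebesgue"
    by (rule measurable_completion) simp
  have FT: "(\<lambda>\<eta>. F (cot_half_angle \<eta>)) \<in> borel_measurable (completion M)"
    by (rule measurable_compose[OF T1 F])
  have "AE \<eta> in completion M. \<eta> \<in> sphere 0 1 \<and> snd \<eta> \<noteq> 1 \<and> 0 < cot_half_angle \<eta>"
    unfolding M_def by (rule AE_completion[OF AE_slice_generic[OF \<tau> k]])
  then have ae: "AE \<eta> in completion M. f \<eta> = F (cot_half_angle \<eta>)"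
    by eventually_elim (simp add: f0 F_def)
  have fM: "f \<in> borel_measurable (completion M)"
    using FT ae by (rule completion.measurable_if_AE_eq)
  have weight: "slice_weight k t s *\<^sub>R F s = C *\<^sub>R (indicator {t<..} s *\<^sub>R F0_integrand k f0 t s)" for s
    using t by (simp add: slice_weight_def slice_density_def F0_integrand_def C_def F_def indicator_def)
  have "integrable (slice_measure \<tau>) f \<longleftrightarrow> integrable (completion M) (\<lambda>\<eta>. F (cot_half_angle \<eta>))"
    unfolding slice_measure_eq_completion M_def[symmetric]
    using fM FT ae by (rule integrable_cong_AE)
  also have "\<dots> \<longleftrightarrow> integrable (density lebesgue (slice_weight k t)) F"
    unfolding T2[symmetric] by (rule integrable_distr_eq[symmetric]) simp_all
  also have "\<dots> \<longleftrightarrow> integrable lebesgue (\<lambda>s. slice_weight k t s *\<^sub>R F s)"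
    using slice_weight_nonneg[OF t] by (intro integrable_density) simp_all
  also have "\<dots> \<longleftrightarrow> set_integrable lebesgue {t<..} (F0_integrand k f0 t)"
    unfolding weight set_integrable_def using C by (rule integrable_scaleR_iff)
  finally show "integrable (slice_measure \<tau>) f \<longleftrightarrow> set_integrable lebesgue {t<..} (F0_integrand k f0 t)" .
  have "slice_transform f \<tau> = (\<integral>\<eta>. F (cot_half_angle \<eta>) \<partial>completion M)"
    unfolding slice_transform_def slice_measure_eq_completion M_def[symmetric]
    using fM FT ae by (rule integral_cong_AE)
  also have "\<dots> = (\<integral>s. F s \<partial>density lebesgue (slice_weight k t))"
    unfolding T2[symmetric] by (rule integral_distr[symmetric]) simp_all
  also have "\<dots> = (\<integral>s. slice_weight k t s *\<^sub>R F s \<partial>lebesgue)"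
    using slice_weight_nonneg[OF t] by (intro integral_density) simp_all
  also have "\<dots> = F0 k f0 t"
    unfolding weight F0_def set_lebesgue_integral_def C_def by (rule integral_scaleR_right)
  finally show "slice_transform f \<tau> = F0 k f0 t" .
qed

text \<open>
  The weight in the Abel integrability condition is that of the hypothesis times \<open>((1 + s\<^sup>2) / s\<^sup>2)\<^sup>e\<close> and
  a constant.  The former factor is bounded away from \<open>s = 0\<close> when \<open>e \<ge> 0\<close>, that is \<open>k \<le> n + 1\<close>.
\<close>
lemma abel_weight_eq:
  fixes s :: real
  assumes s: "0 < s" and k: "2 \<le> k" and n: "1 \<le> n"
  defines "e \<equiv> (real n + 1 - real k) / 2"
  shows "s ^ (k - 2) / (1 + s\<^sup>2) ^ (k - 1) =
    ((1 + s\<^sup>2) / s\<^sup>2) powr e * (2 powr e / (2 ^ n * sphere_area (n - 1))) *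
      (slice_density (n + 1) 0 s / (2 / (1 + s\<^sup>2)) powr e)"
proof -
  define Q where "Q = 1 + s\<^sup>2"
  have Q: "Q > 0" by (simp add: Q_def add_pos_nonneg)
  have e2: "2 * e = real n + 1 - real k" by (simp add: e_def)
  have sa: "sphere_area (n - 1) > 0" by (rule sphere_area_pos)
  have dens: "slice_density (n + 1) 0 s = 2 ^ n * sphere_area (n - 1) * (s powr (real n - 1) / Q powr real n)"
  proof -
    have "(s\<^sup>2) powr ((real n - 2) / 2) = s powr (real n - 2)"
      using s by (simp add: powr_powr diff_divide_distrib flip: powr_numeral)
    moreover have "s powr (real n - 2) * s = s powr (real n - 1)"
      using s powr_add[of s "real n - 2" 1] by simp
    ultimately show ?thesis
      using Q n by (simp add: slice_density_def Q_def[symmetric] powr_realpow add_diff_eq)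
  qed
  have "s ^ (k - 2) / Q ^ (k - 1) = s powr (real k - 2) / Q powr (real k - 1)"
    using s Q k by (simp add: powr_realpow[symmetric] of_nat_diff)
  also have "\<dots> = (Q powr e / s powr (2 * e)) * (s powr (real n - 1) / Q powr real n * Q powr e)"
  proof -
    have "s powr (real k - 2) * s powr (2 * e) = s powr (real n - 1)"
      unfolding powr_add[symmetric] e2 by simp
    moreover have "Q powr (real k - 1) * (Q powr e * Q powr e) = Q powr real n"
    proof -
      have "real k - 1 + (e + e) = real n" using e2 by simp
      then show ?thesis by (simp only: powr_add[symmetric])
    qed
    ultimately show ?thesis using s Q
      by (simp add: divide_simps) (metis (no_types, opaque_lifting) mult.commute mult.left_commute)
  qed
  also have "\<dots> = (Q / s\<^sup>2) powr e * (2 powr e / (2 ^ n * sphere_area (n - 1))) *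
      (slice_density (n + 1) 0 s / (2 / Q) powr e)"
  proof -
    have "(s\<^sup>2) powr e = s powr (2 * e)"
      using s by (simp add: powr_powr diff_divide_distrib flip: powr_numeral)
    then show ?thesis using s Q sa unfolding dens by (simp add: powr_divide)
  qed
  finally show ?thesis by (simp add: Q_def)
qed

text \<open>
  Transported to the half-line by the law of \<open>cot (\<phi> / 2)\<close> on the whole sphere, the hypothesis says that the
  profile is integrable against a weight which on every \<open>{a<..}\<close> dominates, up to a constant, the one in
  \<open>AE_abel_integral_finite\<close>.
\<close>
lemma zonal_slice_integrable_AE:
  fixes f :: "(real^'n) \<times> real \<Rightarrow> 'b::{banach, second_countable_topology}"
  assumes k: "2 \<le> k" "k \<le> CARD('n)"
    and f: "f \<in> borel_measurable (sphere_measure UNIV 0 1)"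
    and f0: "\<And>\<eta>. \<eta> \<in> sphere 0 1 \<Longrightarrow> snd \<eta> \<noteq> 1 \<Longrightarrow> f \<eta> = f0 (cot_half_angle \<eta>)"
    and fin: "(\<integral>\<^sup>+\<eta>\<in>{\<eta> \<in> sphere 0 1. snd \<eta> > -1}.
         ennreal (norm (f \<eta>) / (1 - snd \<eta>) powr ((real CARD('n) + 1 - real k) / 2))
         \<partial>sphere_measure UNIV 0 1) < \<infinity>"
  shows "AE t in lborel. 0 < t \<longrightarrow> set_integrable lebesgue {t<..} (F0_integrand k f0 t)"
proof -
  define n where "n = CARD('n)"
  define e where "e = (real n + 1 - real k) / 2"
  define M where "M = borel_slice_measure (UNIV :: ((real^'n) \<times> real) set)"
  define F where "F = (\<lambda>s. if 0 < s then f0 s else 0)"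
  have n: "1 \<le> n" "k \<le> n" using k by (auto simp: n_def)
  have e: "e \<ge> 0" using n by (simp add: e_def)
  have pl: "(UNIV :: ((real^'n) \<times> real) set) \<in> slice_planes (n + 1)" "2 \<le> n + 1"
    using UNIV_in_slice_planes n by (auto simp: n_def)
  have SM: "sphere_measure UNIV 0 1 = completion M"
    by (simp add: M_def borel_slice_measure_UNIV sphere_measure_eq_completion)
  have F [measurable]: "F \<in> borel_measurable lebesgue"
    unfolding F_def using f f0 by (rule measurable_profile)
  have "distr M borel cot_half_angle = density lborel (slice_weight (n + 1) 0)"
    using distr_slice_cot_half_angle[OF pl] by (simp add: M_def)
  note T = distr_completion_density[OF _ _ this]
  have T1 [measurable]: "cot_half_angle \<in> completion M \<rightarrow>\<^sub>M lebesgue" by (rule T(1)) (simp_all add: M_def)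
  have T2: "distr (completion M) lebesgue cot_half_angle = density lebesgue (slice_weight (n + 1) 0)"
    by (rule T(2)) (simp_all add: M_def)
  \<comment> \<open>A Borel version of the norm of the profile, so that Tonelli applies to Borel functions.\<close>
  obtain N where N [measurable]: "N \<in> borel_measurable borel" and FN: "AE s in lborel. ennreal (norm (F s)) = N s"
    using completion_ex_borel_measurable[of "\<lambda>s. ennreal (norm (F s))" lborel] by auto
  define H where "H s = N s * ennreal (1 / (2 / (1 + s\<^sup>2)) powr e)" for s
  have H [measurable]: "H \<in> borel_measurable borel" unfolding H_def by measurable
  define H' where "H' s = ennreal (norm (F s)) * ennreal (1 / (2 / (1 + s\<^sup>2)) powr e)" for s
  have [measurable]: "(\<lambda>s. ennreal (1 / (2 / (1 + s\<^sup>2)) powr e)) \<in> borel_measurable lebesgue"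
    by (rule measurable_completion) simp
  have H' [measurable]: "H' \<in> borel_measurable lebesgue" unfolding H'_def by measurable
  have W: "(\<lambda>s. ennreal (slice_weight (n + 1) 0 s)) \<in> borel_measurable lebesgue"
    by (rule measurable_completion) simp
  have "AE \<eta> in completion M. \<eta> \<in> sphere 0 1 \<and> snd \<eta> \<noteq> 1 \<and> 0 < cot_half_angle \<eta>"
    unfolding M_def by (rule AE_completion[OF AE_slice_generic[OF pl]])
  then have "AE \<eta> in completion M.
      ennreal (norm (f \<eta>) / (1 - snd \<eta>) powr e) * indicator {\<eta> \<in> sphere 0 1. snd \<eta> > -1} \<eta> = H' (cot_half_angle \<eta>)"
  proof eventually_elim
    case (elim \<eta>)
    define h where "h = snd \<eta>"
    have "\<bar>h\<bar> \<le> 1" using elim norm_snd_le[of "snd \<eta>" "fst \<eta>"] by (simp add: h_def)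
    then have h: "h < 1" "-1 \<le> h" using elim by (auto simp: h_def)
    have "(1 + h) / (1 - h) > 0" using elim by (simp add: cot_half_angle_def h_def)
    then have h1: "-1 < h" using h by (auto simp: zero_less_divide_iff)
    have "1 + (cot_half_angle \<eta>)\<^sup>2 = 2 / (1 - h)"
      using h by (simp add: cot_half_angle_def h_def[symmetric] field_simps)
    then have "2 / (1 + (cot_half_angle \<eta>)\<^sup>2) = 1 - h" by simp
    then show ?case
      using elim h1 by (simp add: H'_def F_def f0 h_def indicator_def ennreal_mult[symmetric])
  qed
  note nn_integral_cong_AE[OF this, symmetric]
  also note fin[unfolded SM n_def[symmetric], folded e_def]
  finally have "(\<integral>\<^sup>+\<eta>. H' (cot_half_angle \<eta>) \<partial>completion M) < \<infinity>" .
  also have "(\<integral>\<^sup>+\<eta>. H' (cot_half_angle \<eta>) \<partial>completion M) =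
             (\<integral>\<^sup>+s. H' s \<partial>density lebesgue (slice_weight (n + 1) 0))"
    unfolding T2[symmetric] by (rule nn_integral_distr[symmetric]) simp_all
  also have "\<dots> = (\<integral>\<^sup>+s. ennreal (slice_weight (n + 1) 0 s) * H' s \<partial>lebesgue)"
    using W by (intro nn_integral_density) simp_all
  also have "\<dots> = (\<integral>\<^sup>+s. ennreal (slice_weight (n + 1) 0 s) * H s \<partial>lebesgue)"
    by (intro nn_integral_cong_AE, use AE_completion[OF FN] in eventually_elim) (simp add: H_def H'_def)
  also have "\<dots> = (\<integral>\<^sup>+s. ennreal (slice_weight (n + 1) 0 s) * H s \<partial>lborel)"
    by (rule nn_integral_completion)
  finally have finH: "(\<integral>\<^sup>+s. ennreal (slice_weight (n + 1) 0 s) * H s \<partial>lborel) < \<infinity>" .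
  have "AE t in lborel. 0 < t \<longrightarrow>
     (\<integral>\<^sup>+s. N s * ennreal ((s\<^sup>2 - t\<^sup>2) powr ((real k - 3) / 2) * s / (1 + s\<^sup>2) ^ (k - 1)) *
        indicator {t<..} s \<partial>lborel) < \<infinity>"
  proof (rule AE_abel_integral_finite[OF k(1) N])
    fix a :: real assume a: "0 < a"
    \<comment> \<open>The bound for \<open>s > a\<close> of the first two factors in the identity between the weights.\<close>
    define c where "c = (1 + 1 / a\<^sup>2) powr e * (2 powr e / (2 ^ n * sphere_area (n - 1)))"
    have c0: "2 powr e / (2 ^ n * sphere_area (n - 1)) \<ge> 0"
      using sphere_area_pos[of "n - 1"] by (intro divide_nonneg_nonneg mult_nonneg_nonneg) auto
    then have c: "c \<ge> 0" unfolding c_def by (intro mult_nonneg_nonneg) simp_all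
    have "(\<integral>\<^sup>+s. N s * ennreal (s ^ (k - 2) / (1 + s\<^sup>2) ^ (k - 1)) * indicator {a<..} s \<partial>lborel) \<le>
          (\<integral>\<^sup>+s. ennreal c * (ennreal (slice_weight (n + 1) 0 s) * H s) \<partial>lborel)"
    proof (rule nn_integral_mono)
      fix s
      show "N s * ennreal (s ^ (k - 2) / (1 + s\<^sup>2) ^ (k - 1)) * indicator {a<..} s \<le>
            ennreal c * (ennreal (slice_weight (n + 1) 0 s) * H s)"
      proof (cases "s > a")
        case True
        then have s: "s > 0" using a by simp
        let ?w = "slice_weight (n + 1) 0 s" and ?p = "1 / (2 / (1 + s\<^sup>2)) powr e"
        have w: "?w = slice_density (n + 1) 0 s" "?w \<ge> 0"
          using s slice_weight_nonneg[of 0 "n + 1" s] by (simp add: slice_weight_def, simp)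
        have "a\<^sup>2 \<le> s\<^sup>2" using True a by (intro power_mono) auto
        then have "1 / s\<^sup>2 \<le> 1 / a\<^sup>2" using a s by (intro divide_left_mono) auto
        then have "(1 + s\<^sup>2) / s\<^sup>2 \<le> 1 + 1 / a\<^sup>2" using s by (simp add: add_divide_distrib)
        then have "((1 + s\<^sup>2) / s\<^sup>2) powr e \<le> (1 + 1 / a\<^sup>2) powr e"
          using s e by (intro powr_mono2) auto
        moreover have "?w * ?p \<ge> 0" using w(2) by simp
        ultimately have "((1 + s\<^sup>2) / s\<^sup>2) powr e * (2 powr e / (2 ^ n * sphere_area (n - 1))) * (?w * ?p)
            \<le> c * (?w * ?p)"
          unfolding c_def using c0 by (intro mult_right_mono)
        moreover have "?w * ?p = ?w / (2 / (1 + s\<^sup>2)) powr e" by simp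
        ultimately have "s ^ (k - 2) / (1 + s\<^sup>2) ^ (k - 1) \<le> c * (?w * ?p)"
          using abel_weight_eq[OF s k(1) n(1), folded e_def w(1)] by (simp only:)
        then have "N s * ennreal (s ^ (k - 2) / (1 + s\<^sup>2) ^ (k - 1)) \<le> N s * ennreal (c * (?w * ?p))"
          by (intro mult_left_mono ennreal_leI) simp_all
        also have "\<dots> = ennreal c * (ennreal ?w * H s)"
        proof -
          have p0: "0 \<le> ?p" by simp
          have m: "ennreal (c * (x * y)) = ennreal c * (ennreal x * ennreal y)" if "x \<ge> 0" "y \<ge> 0" for x y
            using c that by (simp add: ennreal_mult)
          show ?thesis unfolding H_def m[OF w(2) p0] by (simp only: ac_simps)
        qed
        finally show ?thesis using True by simp
      qed simp
    qed
    also have "\<dots> = ennreal c * (\<integral>\<^sup>+s. ennreal (slice_weight (n + 1) 0 s) * H s \<partial>lborel)"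
      by (rule nn_integral_cmult) simp
    also have "\<dots> < \<infinity>" using finH by (simp add: ennreal_mult_less_top)
    finally show "(\<integral>\<^sup>+s. N s * ennreal (s ^ (k - 2) / (1 + s\<^sup>2) ^ (k - 1)) * indicator {a<..} s \<partial>lborel) < \<infinity>" .
  qed
  then show ?thesis
  proof (rule eventually_mono, intro impI)
    fix t :: real
    define K where "K s = (s\<^sup>2 - t\<^sup>2) powr ((real k - 3) / 2) * s / (1 + s\<^sup>2) ^ (k - 1)" for s
    assume "0 < t \<longrightarrow> (\<integral>\<^sup>+s. N s * ennreal ((s\<^sup>2 - t\<^sup>2) powr ((real k - 3) / 2) * s / (1 + s\<^sup>2) ^ (k - 1)) *
        indicator {t<..} s \<partial>lborel) < \<infinity>" and t: "0 < t"
    then have fin: "(\<integral>\<^sup>+s. N s * ennreal (K s) * indicator {t<..} s \<partial>lborel) < \<infinity>" by (simp add: K_def)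
    have [measurable]: "(\<lambda>s. indicator {t<..} s * K s) \<in> borel_measurable lebesgue"
      unfolding K_def by (rule measurable_completion) simp
    have K: "indicator {t<..} s * K s \<ge> 0" for s
      using t by (auto simp: K_def indicator_def)
    have eq: "indicator {t<..} s *\<^sub>R F0_integrand k f0 t s = (indicator {t<..} s * K s) *\<^sub>R F s" for s
      using t by (simp add: F0_integrand_def K_def F_def indicator_def)
    show "set_integrable lebesgue {t<..} (F0_integrand k f0 t)"
      unfolding set_integrable_def eq
    proof (rule integrableI_bounded)
      have "(\<integral>\<^sup>+s. ennreal (norm ((indicator {t<..} s * K s) *\<^sub>R F s)) \<partial>lebesgue) =
            (\<integral>\<^sup>+s. N s * ennreal (K s) * indicator {t<..} s \<partial>lebesgue)"
      proof (intro nn_integral_cong_AE, use AE_completion[OF FN] in eventually_elim)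
        case (elim s)
        have "ennreal (norm ((indicator {t<..} s * K s) *\<^sub>R F s)) = ennreal (indicator {t<..} s * K s) * N s"
          using K[of s] elim by (simp add: ennreal_mult abs_of_nonneg)
        then show ?case by (simp add: indicator_def mult.commute)
      qed
      also have "\<dots> < \<infinity>" using fin by (simp add: nn_integral_completion)
      finally show "(\<integral>\<^sup>+s. ennreal (norm ((indicator {t<..} s * K s) *\<^sub>R F s)) \<partial>lebesgue) < \<infinity>" .
    qed simp
  qed
qed

theorem proposition4p3:
  fixes f :: "(real^'n) \<times> real \<Rightarrow> 'b::{banach, second_countable_topology}"
    and f0 :: "real \<Rightarrow> 'b"
    and k :: nat
  assumes "2 \<le> CARD('n)" and "2 \<le> k" and "k \<le> CARD('n)"
    and "zonal f"
    and "f \<in> borel_measurable (sphere_measure UNIV 0 1)"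
    and "\<And>\<epsilon>. 0 < \<epsilon> \<Longrightarrow> \<epsilon> \<le> 2 \<Longrightarrow>
      (\<integral>\<^sup>+\<eta>\<in>{\<eta> \<in> sphere 0 1. snd \<eta> > 1 - \<epsilon>}.
         ennreal (norm (f \<eta>) / (1 - snd \<eta>) powr ((real CARD('n) + 1 - real k) / 2))
         \<partial>sphere_measure UNIV 0 1) < \<infinity>"
    and "\<And>\<omega> \<phi>. norm \<omega> = 1 \<Longrightarrow> 0 < \<phi> \<Longrightarrow> \<phi> \<le> pi \<Longrightarrow>
      f (sin \<phi> *\<^sub>R \<omega>, cos \<phi>) = f0 (cot (\<phi> / 2))"
  shows "(\<forall>\<tau> \<in> slice_planes k.
      let t = infdist 0 \<tau> / sqrt (1 - (infdist 0 \<tau>)\<^sup>2)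
      in (integrable (slice_measure \<tau>) f \<longleftrightarrow> set_integrable lebesgue {t<..} (F0_integrand k f0 t))
         \<and> slice_transform f \<tau> = F0 k f0 t)
    \<and> (AE t in lborel. 0 < t \<longrightarrow> set_integrable lebesgue {t<..} (F0_integrand k f0 t))"
proof -
  have profile: "f \<eta> = f0 (cot_half_angle \<eta>)" if \<eta>: "\<eta> \<in> sphere 0 1" "snd \<eta> \<noteq> 1" for \<eta>
  proof -
    obtain \<omega> \<phi> where "norm \<omega> = 1" "0 < \<phi>" "\<phi> \<le> pi" "\<eta> = (sin \<phi> *\<^sub>R \<omega>, cos \<phi>)"
      "cot (\<phi> / 2) = cot_half_angle \<eta>"
      using \<eta> by (rule sphere_point_polar)
    with assms(7)[of \<omega> \<phi>] show ?thesis by simp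
  qed
  have "AE t in lborel. 0 < t \<longrightarrow> set_integrable lebesgue {t<..} (F0_integrand k f0 t)"
    by (rule zonal_slice_integrable_AE[OF assms(2,3,5) profile]) (use assms(6)[of 2] in simp_all)
  then show ?thesis
    using slice_transform_zonal[OF _ assms(2,5) profile] by (simp add: Let_def)
qed

end
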